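(* Let $G=(V,m,E,a)$ be an undirected weighted graph with a collection of undirected clusters $\{\hat E_i\}_{i\in I}$, $\hat E=\bigcup_{i\in I}\hat E_i$, and let $G_\beta=(V,m,E,a_\beta)$, $\beta\in[0,\infty)$, be a family of undirected graphs with $a_0=a$, such that for $\tilde\beta>\beta$ one has $a_{\tilde\beta}(i,j)=a(i,j)$ if $(i,j)\in E\setminus\hat E$ and $a_{\tilde\beta}(i,j)>a_\beta(i,j)$ if $(i,j)\in\hat E$, and such that $a_\beta(i,j)\to\infty$ as $\beta\to\infty$ for every $(i,j)\in\hat E$. Let $L_\beta$ be the Laplacian of $G_\beta$, $L_{\hat E,\beta}$ the Laplacian of $(V,m,\hat E,a_\beta\chi_{\hat E})$, $P$ the orthogonal projection onto $\ker L_{\hat E,\beta}$ (which does not depend on $\beta$), and $\underline L$ the Laplacian of the reduced graph $\underline G$. Then for every $z\in\mathbb C\setminus[0,\infty)$ there are constants $C_1,C_2>0$ independent of $\beta$ such that $$\big\|(L_\beta-zI_{\ell^2(G)})^{-1}-J_\uparrow(\underline L-zI_{\ell^2(\underline G)})^{-1}J_\downarrow\big\|\le C_1\big\|(L_{\hat E,\beta}-z)^{-1}-P/(-z)\big\|\le C_2\,\frac1{\gamma(L_{\hat E,\beta})},$$ where $\gamma(L_{\hat E,\beta})$ is the spectral gap of $L_{\hat E,\beta}$.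
   Context: A weighted graph $G=(V,m,E,a)$ consists of an at most countably infinite vertex set $V$, node masses $m:V\to(0,\infty)$, a locally finite edge set $E\subseteq V\times V$, and a weight function $a:V\times V\to[0,\infty)$ with $a(v,w)>0$ iff $(v,w)\in E$. It is undirected if $E$ and $a$ are symmetric. $\ell^2(G)=\{f:V\to\mathbb C:\sum_v|f(v)|^2m(v)<\infty\}$ with $\langle f,g\rangle_{\ell^2(G)}=\sum_x\overline{f(x)}g(x)m(x)$. The graph Laplacian of an undirected graph is $[Lf](x)=\frac1{m(x)}\big(d(x)f(x)-\sum_{y}a(x,y)f(y)\big)$ with $d(x)=\sum_y a(x,y)$. Standing assumption: for each graph considered ($G$ and every $G_\beta$) there is a constant $C>0$ (possibly depending on the graph) with $d(v)\le C\,m(v)$ for all $v$; thus all Laplacians are bounded on $\ell^2(G)$. Collection of undirected clusters: a countable family of (symmetric, nonempty) edge sets $\hat E_i\subseteq E$, $i\in I$, with node sets $V_i$ (the set of vertices incident to an edge of $\hat E_i$), such that (i) $\sum_{v\in V_i}m(v)<\infty$ for each $i$; (ii) the $V_i$ are pairwise disjoint; (iii) each $(V_i,\hat E_i)$ is connected. Reduced graph $\underline G=(\underline V,\underline m,\underline E,\underline a)$: $\underline V$ is the set of connected components $C\subseteq V$ of $(V,\hat E)$ (a component may be a single vertex not incident to any edge of $\hat E$); $\underline m(C)=\sum_{v\in C}m(v)$; $\underline a(C,D)=\sum_{v\in C,\,w\in D}a(v,w)$; $\underline E=\{(C,D):\underline a(C,D)>0\}$. Its Laplacian $\underline L$ acts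 on $\ell^2(\underline G)$ by the same formula. $J_\downarrow:\ell^2(G)\to\ell^2(\underline G)$, $[J_\downarrow f](C)=\langle\chi_C,f\rangle_{\ell^2(G)}/\underline m(C)$, and $J_\uparrow:\ell^2(\underline G)\to\ell^2(G)$, $J_\uparrow\underline f=\sum_{C\in\underline V}\underline f(C)\chi_C$, where $\chi_C$ is the indicator function of $C$. The spectral gap of a non-negative operator $L$ is $\gamma(L)=\inf(\sigma(L)\setminus\{0\})$; if $\gamma(L)=0$, then $1/\gamma(L)$ is read as $+\infty$. *)

theory Defs
  imports "HOL-Analysis.Analysis"
begin

section \<open>Weighted graphs\<close>

record 'v wgraph =
  verts :: "'v set"
  mass :: "'v \<Rightarrow> real"
  edges :: "('v \<times> 'v) set"
  weight :: "'v \<Rightarrow> 'v \<Rightarrow> real"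

definition weighted_graph :: "'v wgraph \<Rightarrow> bool" where
  "weighted_graph G \<longleftrightarrow>
     countable (verts G) \<and>
     (\<forall>v\<in>verts G. mass G v > 0) \<and>
     edges G \<subseteq> verts G \<times> verts G \<and>
     (\<forall>v\<in>verts G. finite {w. (v, w) \<in> edges G} \<and> finite {w. (w, v) \<in> edges G}) \<and>
     (\<forall>v\<in>verts G. \<forall>w\<in>verts G.
        weight G v w \<ge> 0 \<and> (weight G v w > 0 \<longleftrightarrow> (v, w) \<in> edges G))"

definition undirected_graph :: "'v wgraph \<Rightarrow> bool" where
  "undirected_graph G \<longleftrightarrow>
     weighted_graph G \<and> sym (edges G) \<and>
     (\<forall>v\<in>verts G. \<forall>w\<in>verts G. weight G v w = weight G w v)"

definition degree :: "'v wgraph \<Rightarrow> 'v \<Rightarrow> real" where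
  "degree G v = (\<Sum>\<^sub>\<infinity>w\<in>verts G. weight G v w)"

definition bounded_degree :: "'v wgraph \<Rightarrow> bool" where
  "bounded_degree G \<longleftrightarrow> (\<exists>C>0. \<forall>v\<in>verts G. degree G v \<le> C * mass G v)"


section \<open>The weighted sequence space and operators on it\<close>

text \<open>Functions on the vertex set are total functions vanishing off it, so that
  equality of elements of the space is equality of functions.\<close>

definition ell2 :: "'v wgraph \<Rightarrow> ('v \<Rightarrow> complex) set" where
  "ell2 G = {f. (\<forall>v. v \<notin> verts G \<longrightarrow> f v = 0) \<and>
                (\<lambda>v. (cmod (f v))\<^sup>2 * mass G v) summable_on verts G}"

definition ell2_inner :: "'v wgraph \<Rightarrow> ('v \<Rightarrow> complex) \<Rightarrow> ('v \<Rightarrow> complex) \<Rightarrow> complex" where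
  "ell2_inner G f g = (\<Sum>\<^sub>\<infinity>x\<in>verts G. cnj (f x) * g x * complex_of_real (mass G x))"

definition ell2_norm :: "'v wgraph \<Rightarrow> ('v \<Rightarrow> complex) \<Rightarrow> real" where
  "ell2_norm G f = sqrt (\<Sum>\<^sub>\<infinity>v\<in>verts G. (cmod (f v))\<^sup>2 * mass G v)"

text \<open>The operator norm is extended-real valued; it is \<open>\<infinity>\<close> for maps that are unbounded
  or do not map the space into itself.\<close>

definition op_norm :: "'v wgraph \<Rightarrow> (('v \<Rightarrow> complex) \<Rightarrow> ('v \<Rightarrow> complex)) \<Rightarrow> ereal" where
  "op_norm G T = (SUP f\<in>{f \<in> ell2 G. ell2_norm G f \<le> 1}.
     if T f \<in> ell2 G then ereal (ell2_norm G (T f)) else \<infinity>)"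

text \<open>\<open>resolvent G T z\<close> is \<open>(T - z)\<^sup>-\<^sup>1\<close>; it is meaningful for \<open>z\<close> off the spectrum.\<close>

definition resolvent ::
    "'v wgraph \<Rightarrow> (('v \<Rightarrow> complex) \<Rightarrow> ('v \<Rightarrow> complex)) \<Rightarrow> complex \<Rightarrow>
     ('v \<Rightarrow> complex) \<Rightarrow> ('v \<Rightarrow> complex)" where
  "resolvent G T z = inv_into (ell2 G) (\<lambda>f x. T f x - z * f x)"

definition spectrum :: "'v wgraph \<Rightarrow> (('v \<Rightarrow> complex) \<Rightarrow> ('v \<Rightarrow> complex)) \<Rightarrow> complex set" where
  "spectrum G T = {z. \<not> (bij_betw (\<lambda>f x. T f x - z * f x) (ell2 G) (ell2 G) \<and>
                          op_norm G (resolvent G T z) < \<infinity>)}"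

text \<open>For non-negative operators, whose spectrum is real. The value is \<open>\<infinity>\<close> if the
  spectrum has no nonzero element; in \<open>ereal\<close>, \<open>1 / 0 = \<infinity>\<close> and \<open>1 / \<infinity> = 0\<close>.\<close>

definition spectral_gap :: "'v wgraph \<Rightarrow> (('v \<Rightarrow> complex) \<Rightarrow> ('v \<Rightarrow> complex)) \<Rightarrow> ereal" where
  "spectral_gap G T = Inf {ereal r | r. complex_of_real r \<in> spectrum G T - {0}}"

definition op_kernel ::
    "'v wgraph \<Rightarrow> (('v \<Rightarrow> complex) \<Rightarrow> ('v \<Rightarrow> complex)) \<Rightarrow> ('v \<Rightarrow> complex) set" where
  "op_kernel G T = {f \<in> ell2 G. T f = (\<lambda>_. 0)}"

definition is_orth_proj ::
    "'v wgraph \<Rightarrow> (('v \<Rightarrow> complex) \<Rightarrow> ('v \<Rightarrow> complex)) \<Rightarrow> ('v \<Rightarrow> complex) set \<Rightarrow> bool" where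
  "is_orth_proj G P S \<longleftrightarrow>
     (\<forall>f\<in>ell2 G. P f \<in> S \<and> (\<forall>g\<in>S. ell2_inner G g (\<lambda>x. f x - P f x) = 0))"

definition laplacian :: "'v wgraph \<Rightarrow> ('v \<Rightarrow> complex) \<Rightarrow> ('v \<Rightarrow> complex)" where
  "laplacian G f x =
     (if x \<in> verts G then
        (complex_of_real (degree G x) * f x
           - (\<Sum>\<^sub>\<infinity>y\<in>verts G. complex_of_real (weight G x y) * f y))
        / complex_of_real (mass G x)
      else 0)"


section \<open>Clusters and the reduced graph\<close>

definition undirected_clusters :: "'v wgraph \<Rightarrow> 'i set \<Rightarrow> ('i \<Rightarrow> ('v \<times> 'v) set) \<Rightarrow> bool" where
  "undirected_clusters G I Eh \<longleftrightarrow>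
     countable I \<and>
     (\<forall>i\<in>I. Eh i \<noteq> {} \<and> Eh i \<subseteq> edges G \<and> sym (Eh i)) \<and>
     (\<forall>i\<in>I. mass G summable_on Field (Eh i)) \<and>
     (\<forall>i\<in>I. \<forall>j\<in>I. i \<noteq> j \<longrightarrow> Field (Eh i) \<inter> Field (Eh j) = {}) \<and>
     (\<forall>i\<in>I. \<forall>v\<in>Field (Eh i). \<forall>w\<in>Field (Eh i). (v, w) \<in> (Eh i)\<^sup>*)"

definition subgraph :: "'v wgraph \<Rightarrow> ('v \<times> 'v) set \<Rightarrow> 'v wgraph" where
  "subgraph G F =
     G\<lparr>edges := F, weight := (\<lambda>v w. if (v, w) \<in> F then weight G v w else 0)\<rparr>"

text \<open>For symmetric \<open>F \<subseteq> V \<times> V\<close> the relation \<open>F\<^sup>*\<close> restricted to \<open>V\<close> is the equivalence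
  relation whose classes are the connected components of \<open>(V, F)\<close>.\<close>

definition components :: "'v wgraph \<Rightarrow> ('v \<times> 'v) set \<Rightarrow> 'v set set" where
  "components G F = verts G // F\<^sup>*"

definition reduced_weight :: "'v wgraph \<Rightarrow> 'v set \<Rightarrow> 'v set \<Rightarrow> real" where
  "reduced_weight G C D = (\<Sum>\<^sub>\<infinity>(v, w)\<in>C \<times> D. weight G v w)"

definition reduced_graph :: "'v wgraph \<Rightarrow> ('v \<times> 'v) set \<Rightarrow> 'v set wgraph" where
  "reduced_graph G F =
     \<lparr>verts = components G F,
      mass = (\<lambda>C. \<Sum>\<^sub>\<infinity>v\<in>C. mass G v),
      edges = {(C, D). C \<in> components G F \<and> D \<in> components G F \<and> reduced_weight G C D > 0},
      weight = reduced_weight G\<rparr>"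

definition J_down :: "'v wgraph \<Rightarrow> ('v \<times> 'v) set \<Rightarrow> ('v \<Rightarrow> complex) \<Rightarrow> ('v set \<Rightarrow> complex)" where
  "J_down G F f C =
     (if C \<in> components G F
      then ell2_inner G (indicator C) f / complex_of_real (mass (reduced_graph G F) C)
      else 0)"

definition J_up :: "'v wgraph \<Rightarrow> ('v \<times> 'v) set \<Rightarrow> ('v set \<Rightarrow> complex) \<Rightarrow> ('v \<Rightarrow> complex)" where
  "J_up G F g x = (\<Sum>\<^sub>\<infinity>C\<in>components G F. g C * indicator C x)"

end

theory Submission
  imports Defs
begin

text \<open>
  Write \<open>L = R + S\<close> with \<open>S\<close> the Laplacian of the clusters and \<open>R\<close> the part coming from the
  edges outside the clusters, which does not depend on \<open>\<beta>\<close>. The kernel of \<open>S\<close> consists of the functions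
  that are constant on components, so \<open>P = J_up J_down\<close>, where \<open>J_up\<close> is an isometry with adjoint
  \<open>J_down\<close>, and the reduced Laplacian is \<open>J_down R J_up\<close>. Let \<open>X = (S - z)\<^sup>-\<^sup>1 + P / z\<close>. For
  \<open>u = (L - z)\<^sup>-\<^sup>1 f\<close> one has \<open>u - P u = X (f - R u)\<close>, and the component \<open>P u\<close> solves the reduced
  equation up to a term controlled by \<open>u - P u\<close>. This gives the first inequality with
  \<open>C\<^sub>1 = (1 + \<parallel>R\<parallel> / \<delta>)\<^sup>2\<close>, where \<open>\<delta>\<close> bounds the distance of \<open>z\<close> to \<open>[0, \<infinity>)\<close> from below.

  For the second one it suffices that \<open>\<gamma> \<parallel>w\<parallel> \<le> \<parallel>S w\<parallel>\<close> for \<open>w\<close> orthogonal to the kernel of \<open>S\<close>.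
  In place of the spectral theorem, a variational argument shows \<open>\<gamma> S \<le> S\<^sup>2\<close>, from which the estimate
  follows on the range of \<open>S\<close> and, by completeness, on its closure.
\<close>

section \<open>The weighted sequence space as a Hilbert space\<close>

text \<open>Uniformity in \<beta> shapes the argument. The degree constants of the graphs, and with
  them the norms of the full and of the cluster Laplacian, may grow with \<beta>, so no final
  estimate may contain them. Two quantities stay fixed: a bound for R, which involves only edges
  whose weights do not move, and the separation \<delta> of z from the half line, which bounds the
  resolvent of every nonnegative operator by 1 / \<delta>, upstairs and in the reduced graph alike.
  In the code the norm of R is replaced by 2 C, with C a degree constant of G. The square in
  \<open>C\<^sub>1\<close> has two sources: one factor compares f - R u with f, the other compares
  the difference of the resolvents with u - P u. The second inequality adds the factor 1 + |z| /
  \<delta>. For w = X h one has S w = (h - P h) + z w, and \<gamma> |w| \<le> |S w| is closed by |w|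
  \<le> |h| / \<delta>.\<close>

lemma infsum_complex_of_real:
  "(\<Sum>\<^sub>\<infinity>x\<in>A. complex_of_real (f x)) = complex_of_real (\<Sum>\<^sub>\<infinity>x\<in>A. f x)"
proof (cases "f summable_on A")
  case True
  then show ?thesis by (intro infsumI has_sum_of_real has_sum_infsum)
next
  \<comment> \<open>Both infinite sums take the default value 0 here, so the identity holds without
    a summability hypothesis.\<close>
  case False
  then have "\<not> (\<lambda>x. complex_of_real (f x)) summable_on A"
    using summable_on_Re by fastforce
  then show ?thesis using False by (simp add: infsum_not_exists)
qed

text \<open>Only positive masses are required, so that one theory serves the given graph and the
  reduced graph, whose vertex types differ.\<close>

locale mass_space =
  fixes H :: "'v wgraph"
  assumes mass_pos: "v \<in> verts H \<Longrightarrow> 0 < mass H v"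
begin

abbreviation "E \<equiv> ell2 H"
abbreviation "ip \<equiv> ell2_inner H"
abbreviation "N \<equiv> ell2_norm H"

lemma E_outside: "f \<in> E \<Longrightarrow> v \<notin> verts H \<Longrightarrow> f v = 0"
  by (simp add: ell2_def)

lemma E_summable: "f \<in> E \<Longrightarrow> (\<lambda>v. (cmod (f v))\<^sup>2 * mass H v) summable_on verts H"
  by (simp add: ell2_def)

lemma zero_in_E [simp]: "(\<lambda>_. 0) \<in> E"
  by (simp add: ell2_def)

lemma scale_in_E [simp]:
  assumes "f \<in> E"
  shows "(\<lambda>x. c * f x) \<in> E"
proof -
  have "(\<lambda>v. (cmod c)\<^sup>2 * ((cmod (f v))\<^sup>2 * mass H v)) summable_on verts H"
    using E_summable[OF assms] by (rule summable_on_cmult_right)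
  then show ?thesis using assms
    by (simp add: ell2_def norm_mult power_mult_distrib mult.assoc)
qed

lemma add_in_E [simp]:
  assumes "f \<in> E" "g \<in> E"
  shows "(\<lambda>x. f x + g x) \<in> E"
proof -
  have b: "(cmod (f v + g v))\<^sup>2 * mass H v
      \<le> 2 * ((cmod (f v))\<^sup>2 * mass H v) + 2 * ((cmod (g v))\<^sup>2 * mass H v)"
    if "v \<in> verts H" for v
  proof -
    have "(cmod (f v + g v))\<^sup>2 \<le> (cmod (f v) + cmod (g v))\<^sup>2"
      by (intro power_mono norm_triangle_ineq) auto
    also have "\<dots> \<le> 2 * (cmod (f v))\<^sup>2 + 2 * (cmod (g v))\<^sup>2"
      using sum_squares_bound[of "cmod (f v)" "cmod (g v)"] by (simp add: power2_sum)
    finally have "(cmod (f v + g v))\<^sup>2 * mass H v \<le> (2 * (cmod (f v))\<^sup>2 + 2 * (cmod (g v))\<^sup>2) * mass H v"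
      using mass_pos[OF that] by (intro mult_right_mono) auto
    then show ?thesis by (simp add: distrib_right mult.assoc)
  qed
  have "(\<lambda>v. (cmod (f v + g v))\<^sup>2 * mass H v) summable_on verts H"
    by (rule summable_on_comparison_test[OF summable_on_add[OF
          summable_on_cmult_right[OF E_summable[OF assms(1)], of 2]
          summable_on_cmult_right[OF E_summable[OF assms(2)], of 2]]])
      (use b less_imp_le[OF mass_pos] in auto)
  then show ?thesis using assms by (simp add: ell2_def)
qed

lemma uminus_in_E [simp]: "f \<in> E \<Longrightarrow> (\<lambda>x. - f x) \<in> E"
  using scale_in_E[of f "-1"] by simp

lemma diff_in_E [simp]: "f \<in> E \<Longrightarrow> g \<in> E \<Longrightarrow> (\<lambda>x. f x - g x) \<in> E"
  using add_in_E[of f "\<lambda>x. - g x"] by simp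

lemma divide_in_E [simp]: "f \<in> E \<Longrightarrow> (\<lambda>x. f x / c) \<in> E"
  using scale_in_E[of f "inverse c"] by (simp add: divide_inverse mult.commute)

section \<open>Inner product, norm and the Cauchy-Schwarz inequality\<close>

lemma ip_summable:
  assumes "f \<in> E" "g \<in> E"
  shows "(\<lambda>x. cnj (f x) * g x * complex_of_real (mass H x)) summable_on verts H"
proof (rule abs_summable_summable[OF Infinite_Sum.abs_summable_on_comparison_test'])
  show "(\<lambda>v. (cmod (f v))\<^sup>2 * mass H v + (cmod (g v))\<^sup>2 * mass H v) summable_on verts H"
    by (intro summable_on_add E_summable assms)
  fix v assume v: "v \<in> verts H"
  have "cmod (f v) * cmod (g v) \<le> (cmod (f v))\<^sup>2 + (cmod (g v))\<^sup>2"
    using sum_squares_bound[of "cmod (f v)" "cmod (g v)"]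
      mult_nonneg_nonneg[OF norm_ge_zero[of "f v"] norm_ge_zero[of "g v"]] by linarith
  then have "cmod (f v) * cmod (g v) * mass H v \<le> ((cmod (f v))\<^sup>2 + (cmod (g v))\<^sup>2) * mass H v"
    using mass_pos[OF v] by (intro mult_right_mono) auto
  then show "cmod (cnj (f v) * g v * complex_of_real (mass H v))
      \<le> (cmod (f v))\<^sup>2 * mass H v + (cmod (g v))\<^sup>2 * mass H v"
    using mass_pos[OF v] by (simp add: norm_mult distrib_right)
qed

lemma ip_cnj: "cnj (ip f g) = ip g f"
  unfolding ell2_inner_def by (simp add: mult.commute flip: infsum_cnj)

lemma ip_add_right:
  assumes "f \<in> E" "g \<in> E" "h \<in> E"
  shows "ip f (\<lambda>x. g x + h x) = ip f g + ip f h"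
  unfolding ell2_inner_def infsum_add[OF ip_summable[OF assms(1,2)] ip_summable[OF assms(1,3)], symmetric]
  by (simp add: algebra_simps)

lemma ip_scale_right: "ip f (\<lambda>x. c * g x) = c * ip f g"
  unfolding ell2_inner_def
  by (subst infsum_cmult_right'[symmetric]) (simp add: algebra_simps)

lemma ip_uminus_right: "ip f (\<lambda>x. - g x) = - ip f g"
  using ip_scale_right[of f "-1" g] by simp

lemma ip_diff_right:
  "f \<in> E \<Longrightarrow> g \<in> E \<Longrightarrow> h \<in> E \<Longrightarrow> ip f (\<lambda>x. g x - h x) = ip f g - ip f h"
  using ip_add_right[of f g "\<lambda>x. - h x"] by (simp add: ip_uminus_right)

lemma ip_add_left:
  "f \<in> E \<Longrightarrow> g \<in> E \<Longrightarrow> h \<in> E \<Longrightarrow> ip (\<lambda>x. g x + h x) f = ip g f + ip h f"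
  by (simp add: ip_cnj[of f, symmetric] ip_add_right)

lemma ip_diff_left:
  "f \<in> E \<Longrightarrow> g \<in> E \<Longrightarrow> h \<in> E \<Longrightarrow> ip (\<lambda>x. g x - h x) f = ip g f - ip h f"
  by (simp add: ip_cnj[of f, symmetric] ip_diff_right)

lemma ip_scale_left: "ip (\<lambda>x. c * g x) f = cnj c * ip g f"
  by (simp add: ip_cnj[of f, symmetric] ip_scale_right)

lemmas ip_simps = ip_add_right ip_diff_right ip_scale_right ip_add_left ip_diff_left ip_scale_left

lemma N_nonneg [simp]: "0 \<le> N f"
  unfolding ell2_norm_def
  by (intro real_sqrt_ge_zero infsum_nonneg mult_nonneg_nonneg) (auto intro: less_imp_le mass_pos)

lemma N_sq: "(N f)\<^sup>2 = (\<Sum>\<^sub>\<infinity>v\<in>verts H. (cmod (f v))\<^sup>2 * mass H v)"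
  unfolding ell2_norm_def
  by (intro real_sqrt_pow2 infsum_nonneg mult_nonneg_nonneg) (auto intro: less_imp_le mass_pos)

lemma ip_self: "ip f f = complex_of_real ((N f)\<^sup>2)"
proof -
  have "ip f f = (\<Sum>\<^sub>\<infinity>v\<in>verts H. complex_of_real ((cmod (f v))\<^sup>2 * mass H v))"
    unfolding ell2_inner_def
    by (rule infsum_cong) (simp add: mult.commute complex_norm_square[symmetric] flip: of_real_power)
  also have "\<dots> = complex_of_real ((N f)\<^sup>2)"
    unfolding N_sq infsum_complex_of_real ..
  finally show ?thesis .
qed

lemma ip_swap_Re: "Re (ip g f) = Re (ip f g)"
  by (simp add: ip_cnj[of f g, symmetric])

lemma N_scale: "N (\<lambda>x. c * f x) = cmod c * N f"
proof -
  have "complex_of_real ((N (\<lambda>x. c * f x))\<^sup>2) = complex_of_real ((cmod c * N f)\<^sup>2)"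
    unfolding ip_self[symmetric] power_mult_distrib
    by (simp add: ip_simps ip_self mult.assoc[symmetric] complex_norm_square[symmetric] power_mult_distrib
        mult.commute[of "cnj c"])
  then have "(N (\<lambda>x. c * f x))\<^sup>2 = (cmod c * N f)\<^sup>2"
    unfolding of_real_eq_iff .
  then show ?thesis by (simp add: power2_eq_iff_nonneg)
qed

lemma N_minus_commute: "N (\<lambda>x. f x - g x) = N (\<lambda>x. g x - f x)"
  using N_scale[of "-1" "\<lambda>x. f x - g x"] by simp

lemma N_zero [simp]: "N (\<lambda>_. 0) = 0"
  using N_scale[of 0] by simp

lemma pointwise_le_N:
  assumes "f \<in> E" "v \<in> verts H"
  shows "(cmod (f v))\<^sup>2 * mass H v \<le> (N f)\<^sup>2"
proof -
  have "(cmod (f v))\<^sup>2 * mass H v = (\<Sum>v\<in>{v}. (cmod (f v))\<^sup>2 * mass H v)" by simp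
  also have "\<dots> \<le> (N f)\<^sup>2"
    unfolding N_sq by (rule finite_sum_le_infsum[OF E_summable[OF assms(1)]])
      (use assms less_imp_le[OF mass_pos] in auto)
  finally show ?thesis .
qed

lemma N_eq_0:
  assumes "f \<in> E" "N f = 0"
  shows "f = (\<lambda>_. 0)"
proof
  fix v
  show "f v = 0"
  proof (cases "v \<in> verts H")
    case True
    then show ?thesis
      using pointwise_le_N[OF assms(1) True] mass_pos[OF True] assms(2)
      by (auto simp: mult_le_0_iff)
  qed (use assms E_outside in auto)
qed

text \<open>Stated for arbitrary positive semidefinite Hermitian forms, because the spectral estimates
  below apply it to forms other than the inner product.\<close>

lemma form_Cauchy_Schwarz:
  fixes b :: "('v \<Rightarrow> complex) \<Rightarrow> ('v \<Rightarrow> complex) \<Rightarrow> complex"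
  assumes add: "\<And>f g h. f \<in> E \<Longrightarrow> g \<in> E \<Longrightarrow> h \<in> E \<Longrightarrow> b f (\<lambda>x. g x + h x) = b f g + b f h"
    and scale: "\<And>f g c. f \<in> E \<Longrightarrow> g \<in> E \<Longrightarrow> b f (\<lambda>x. c * g x) = c * b f g"
    and herm: "\<And>f g. f \<in> E \<Longrightarrow> g \<in> E \<Longrightarrow> b g f = cnj (b f g)"
    and pos: "\<And>f. f \<in> E \<Longrightarrow> 0 \<le> Re (b f f)"
    and f: "f \<in> E" and g: "g \<in> E"
  shows "(cmod (b f g))\<^sup>2 \<le> Re (b f f) * Re (b g g)"
proof -
  have quad: "0 \<le> Re (b f f) + 2 * t * (cmod (b f g))\<^sup>2 + t\<^sup>2 * (cmod (b f g))\<^sup>2 * Re (b g g)" for t :: real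
  proof -
    \<comment> \<open>The factor \<open>cnj (b f g)\<close> makes the cross term of the form at f +
      s g real, which leaves a real quadratic in t.\<close>
    define s where "s = complex_of_real t * cnj (b f g)"
    define h where "h = (\<lambda>x. s * g x)"
    have h: "h \<in> E" unfolding h_def using g by simp
    have bfh: "b f h = s * b f g" unfolding h_def by (rule scale[OF f g])
    have bgh: "b g h = s * b g g" unfolding h_def by (rule scale[OF g g])
    have bhg: "b h g = cnj s * cnj (b g g)" using herm[OF g h] bgh by simp
    have bhh: "b h h = s * (cnj s * cnj (b g g))"
      using scale[OF h g, of s] bhg unfolding h_def by simp
    have "b (\<lambda>x. f x + h x) (\<lambda>x. f x + h x) = b (\<lambda>x. f x + h x) f + b (\<lambda>x. f x + h x) h"
      by (rule add) (use f h in auto)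
    also have "b (\<lambda>x. f x + h x) f = cnj (b f f + b f h)"
      using herm[of f "\<lambda>x. f x + h x"] add[OF f f h] f h by simp
    also have "b (\<lambda>x. f x + h x) h = cnj (b h f + b h h)"
      using herm[of h "\<lambda>x. f x + h x"] add[OF h f h] f h by simp
    finally have "0 \<le> Re (cnj (b f f + b f h) + cnj (b h f + b h h))"
      using pos[of "\<lambda>x. f x + h x"] f h by simp
    also have "\<dots> = Re (b f f) + 2 * Re (b f h) + Re (b h h)"
      using herm[OF f h] by simp
    also have "Re (b f h) = t * (cmod (b f g))\<^sup>2"
    proof -
      have "b f h = complex_of_real (t * (cmod (b f g))\<^sup>2)"
        unfolding bfh s_def of_real_mult complex_norm_square by (simp only: mult_ac)
      then show ?thesis by simp
    qed
    also have "Re (b h h) = t\<^sup>2 * (cmod (b f g))\<^sup>2 * Re (b g g)"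
    proof -
      have "s * cnj s = complex_of_real (t\<^sup>2 * (cmod (b f g))\<^sup>2)"
        unfolding complex_norm_square[symmetric] s_def
        by (simp add: norm_mult power_mult_distrib)
      then show ?thesis unfolding bhh mult.assoc[symmetric] by simp
    qed
    finally show ?thesis by simp
  qed
  show ?thesis
  proof (cases "b f g = 0")
    case True
    then show ?thesis using pos f g by simp
  next
    case False
    define B where "B = (cmod (b f g))\<^sup>2"
    have B: "B > 0" using False by (simp add: B_def)
    show ?thesis
    proof (cases "Re (b g g) = 0")
      case True
      have "0 \<le> Re (b f f) + 2 * t * B" for t
        using quad[of t] True by (simp add: B_def)
      \<comment> \<open>If g is null for the form, the quadratic is affine with positive slope; at
        this t it equals -1.\<close>
      from this[of "- (Re (b f f) + 1) / (2 * B)"] B have False by (simp add: field_simps)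
      then show ?thesis ..
    next
      case False
      then have c: "Re (b g g) > 0" using pos[OF g] by simp
      \<comment> \<open>The value t = -1 / \<open>Re (b g g)\<close> minimises the
        quadratic.\<close>
      have "0 \<le> Re (b f f) - B / Re (b g g)"
        using quad[of "- 1 / Re (b g g)", folded B_def] c
        by (simp add: power2_eq_square field_simps)
      then have "B \<le> Re (b f f) * Re (b g g)" using c by (simp add: field_simps)
      then show ?thesis by (simp add: B_def)
    qed
  qed
qed

lemma Cauchy_Schwarz:
  assumes "f \<in> E" "g \<in> E"
  shows "cmod (ip f g) \<le> N f * N g"
proof -
  have "(cmod (ip f g))\<^sup>2 \<le> Re (ip f f) * Re (ip g g)"
    by (rule form_Cauchy_Schwarz) (use assms in \<open>auto simp: ip_simps ip_cnj ip_self\<close>)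
  then have "(cmod (ip f g))\<^sup>2 \<le> (N f * N g)\<^sup>2"
    by (simp add: ip_self power_mult_distrib)
  then show ?thesis by (rule power2_le_imp_le) simp
qed

lemma N_add_sq:
  assumes "f \<in> E" "g \<in> E"
  shows "(N (\<lambda>x. f x + g x))\<^sup>2 = (N f)\<^sup>2 + 2 * Re (ip f g) + (N g)\<^sup>2"
proof -
  have "(N (\<lambda>x. f x + g x))\<^sup>2 = Re (ip (\<lambda>x. f x + g x) (\<lambda>x. f x + g x))"
    by (simp add: ip_self)
  also have "\<dots> = (N f)\<^sup>2 + 2 * Re (ip f g) + (N g)\<^sup>2"
    using assms by (simp add: ip_add_right ip_add_left) (simp add: ip_self ip_swap_Re[of g f])
  finally show ?thesis .
qed

lemma N_diff_sq:
  assumes "f \<in> E" "g \<in> E"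
  shows "(N (\<lambda>x. f x - g x))\<^sup>2 = (N f)\<^sup>2 - 2 * Re (ip f g) + (N g)\<^sup>2"
  using N_add_sq[of f "\<lambda>x. - 1 * g x"] assms ip_scale_right[of f "-1" g] N_scale[of "-1" g]
  by simp

lemma N_triangle:
  assumes "f \<in> E" "g \<in> E"
  shows "N (\<lambda>x. f x + g x) \<le> N f + N g"
proof (rule power2_le_imp_le)
  have "Re (ip f g) \<le> N f * N g"
    using Cauchy_Schwarz[OF assms] complex_Re_le_cmod order_trans by blast
  then show "(N (\<lambda>x. f x + g x))\<^sup>2 \<le> (N f + N g)\<^sup>2"
    by (simp add: N_add_sq[OF assms] power2_sum)
qed simp

lemma N_triangle_diff:
  assumes "f \<in> E" "g \<in> E"
  shows "N (\<lambda>x. f x - g x) \<le> N f + N g"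
  using N_triangle[of f "\<lambda>x. - 1 * g x"] assms N_scale[of "-1" g] by simp

lemma N_triangle_dist:
  assumes "f \<in> E" "g \<in> E" "h \<in> E"
  shows "N (\<lambda>x. f x - h x) \<le> N (\<lambda>x. f x - g x) + N (\<lambda>x. g x - h x)"
  using N_triangle[of "\<lambda>x. f x - g x" "\<lambda>x. g x - h x"] assms by simp

section \<open>Completeness and the contraction principle\<close>

lemma metric: "Metric_space E (\<lambda>f g. N (\<lambda>x. f x - g x))"
proof
  fix f g assume "f \<in> E" "g \<in> E"
  then show "(N (\<lambda>x. f x - g x) = 0) = (f = g)"
    using N_eq_0[of "\<lambda>x. f x - g x"] by (auto simp: fun_eq_iff)
qed (auto intro: N_minus_commute N_triangle_dist)

text \<open>Positive masses turn norm-Cauchy into pointwise Cauchy. The pointwise limit is a norm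
  limit by a Fatou argument: the Cauchy bound passes to the limit in each finite partial sum, and
  finite sums control the infinite one.\<close>

lemma complete:
  fixes s :: "nat \<Rightarrow> 'v \<Rightarrow> complex"
  assumes s: "\<And>n. s n \<in> E"
    and cauchy: "\<And>e. e > 0 \<Longrightarrow> \<exists>M. \<forall>m\<ge>M. \<forall>n\<ge>M. N (\<lambda>x. s m x - s n x) < e"
  shows "\<exists>f\<in>E. (\<lambda>n. N (\<lambda>x. s n x - f x)) \<longlonglongrightarrow> 0"
proof -
  have conv: "convergent (\<lambda>n. s n v)" for v
  proof (cases "v \<in> verts H")
    case True
    note m = mass_pos[OF True]
    have "Cauchy (\<lambda>n. s n v)"
    proof (rule metric_CauchyI)
      fix e :: real assume e: "e > 0"
      then obtain M where M: "\<And>i j. i \<ge> M \<Longrightarrow> j \<ge> M \<Longrightarrow> N (\<lambda>x. s i x - s j x) < e * sqrt (mass H v)"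
        using cauchy[of "e * sqrt (mass H v)"] m by auto
      show "\<exists>M. \<forall>i\<ge>M. \<forall>j\<ge>M. dist (s i v) (s j v) < e"
      proof (intro exI allI impI)
        fix i j assume "i \<ge> M" "j \<ge> M"
        then have "(N (\<lambda>x. s i x - s j x))\<^sup>2 < (e * sqrt (mass H v))\<^sup>2"
          using M by (intro power_strict_mono) auto
        then have "(cmod (s i v - s j v))\<^sup>2 * mass H v < e\<^sup>2 * mass H v"
          using order_le_less_trans[OF pointwise_le_N[of "\<lambda>x. s i x - s j x" v]] s True m
          by (simp add: power_mult_distrib)
        then have "(cmod (s i v - s j v))\<^sup>2 < e\<^sup>2" using m by simp
        then show "dist (s i v) (s j v) < e"
          using power2_less_imp_less[OF _ less_imp_le[OF e]] by (simp add: dist_norm)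
      qed
    qed
    then show ?thesis by (simp add: Cauchy_convergent)
  next
    case False
    then show ?thesis using E_outside[OF s] by (simp add: convergent_const)
  qed
  define f where "f v = lim (\<lambda>n. s n v)" for v
  have f: "(\<lambda>n. s n v) \<longlonglongrightarrow> f v" for v
    using conv[of v] by (simp add: f_def convergent_LIMSEQ_iff)
  have f0: "f v = 0" if "v \<notin> verts H" for v
    using f[of v] E_outside[OF s that] by (simp add: LIMSEQ_const_iff)
  have key: "(\<lambda>x. s m x - f x) \<in> E \<and> N (\<lambda>x. s m x - f x) \<le> e"
    if e: "e > 0" and M: "\<And>n. n \<ge> M \<Longrightarrow> N (\<lambda>x. s m x - s n x) < e" for e m M
  proof -
    have fin: "(\<Sum>v\<in>F. (cmod (s m v - f v))\<^sup>2 * mass H v) \<le> e\<^sup>2" if F: "finite F" "F \<subseteq> verts H" for F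
    proof (rule LIMSEQ_le_const2)
      show "(\<lambda>n. \<Sum>v\<in>F. (cmod (s m v - s n v))\<^sup>2 * mass H v) \<longlonglongrightarrow> (\<Sum>v\<in>F. (cmod (s m v - f v))\<^sup>2 * mass H v)"
        by (intro tendsto_intros f)
      show "\<exists>K. \<forall>n\<ge>K. (\<Sum>v\<in>F. (cmod (s m v - s n v))\<^sup>2 * mass H v) \<le> e\<^sup>2"
      proof (intro exI allI impI)
        fix n assume "n \<ge> M"
        have "(\<Sum>v\<in>F. (cmod (s m v - s n v))\<^sup>2 * mass H v) \<le> (N (\<lambda>x. s m x - s n x))\<^sup>2"
          unfolding N_sq
          by (rule finite_sum_le_infsum[OF E_summable[of "\<lambda>x. s m x - s n x"]])
            (use s F less_imp_le[OF mass_pos] in auto)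
        also have "\<dots> \<le> e\<^sup>2" using M[OF \<open>n \<ge> M\<close>] e by (intro power_mono) auto
        finally show "(\<Sum>v\<in>F. (cmod (s m v - s n v))\<^sup>2 * mass H v) \<le> e\<^sup>2" .
      qed
    qed
    have summ: "(\<lambda>v. (cmod (s m v - f v))\<^sup>2 * mass H v) summable_on verts H"
      by (rule nonneg_bdd_above_summable_on)
        (use fin less_imp_le[OF mass_pos] in \<open>auto intro!: bdd_aboveI2\<close>)
    have "(N (\<lambda>x. s m x - f x))\<^sup>2 \<le> e\<^sup>2"
      unfolding N_sq by (rule infsum_le_finite_sums[OF summ fin])
    then have "N (\<lambda>x. s m x - f x) \<le> e" using e by (rule power2_le_imp_le[OF _ less_imp_le])
    moreover have "(\<lambda>x. s m x - f x) \<in> E"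
      using summ f0 E_outside[OF s] by (auto simp: ell2_def)
    ultimately show ?thesis by simp
  qed
  have key': "\<exists>M. \<forall>m\<ge>M. (\<lambda>x. s m x - f x) \<in> E \<and> N (\<lambda>x. s m x - f x) \<le> e" if e: "e > 0" for e
  proof -
    obtain M where "\<forall>m\<ge>M. \<forall>n\<ge>M. N (\<lambda>x. s m x - s n x) < e" using cauchy[OF e] by blast
    then show ?thesis using key[OF e] by blast
  qed
  obtain m where m: "(\<lambda>x. s m x - f x) \<in> E" using key'[of 1] by auto
  have "f \<in> E" using diff_in_E[OF s[of m] m] by simp
  moreover have "(\<lambda>n. N (\<lambda>x. s n x - f x)) \<longlonglongrightarrow> 0"
  proof (rule LIMSEQ_I)
    fix e :: real assume e: "e > 0"
    then obtain M where M: "\<And>m. m \<ge> M \<Longrightarrow> N (\<lambda>x. s m x - f x) \<le> e / 2"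
      using key'[of "e / 2"] by (meson half_gt_zero)
    have "N (\<lambda>x. s n x - f x) < e" if "n \<ge> M" for n using M[OF that] e by linarith
    then show "\<exists>M. \<forall>n\<ge>M. norm (N (\<lambda>x. s n x - f x) - 0) < e" by auto
  qed
  ultimately show ?thesis by blast
qed

text \<open>Banach's theorem for the metric of the norm; the surjectivity of all shifted operators T
  - z comes from here.\<close>

lemma contraction_fixpoint:
  assumes "\<And>f. f \<in> E \<Longrightarrow> \<Phi> f \<in> E" and "q < 1"
    and "\<And>f g. f \<in> E \<Longrightarrow> g \<in> E \<Longrightarrow> N (\<lambda>x. \<Phi> f x - \<Phi> g x) \<le> q * N (\<lambda>x. f x - g x)"
  obtains f where "f \<in> E" "\<Phi> f = f"
proof -
  interpret Metric_space E "\<lambda>f g. N (\<lambda>x. f x - g x)" by (rule metric)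
  have "mcomplete"
    unfolding mcomplete_def
  proof (intro allI impI)
    fix s assume s: "MCauchy s"
    then have sE: "s n \<in> E" for n by (auto simp: MCauchy_def)
    obtain f where f: "f \<in> E" "(\<lambda>n. N (\<lambda>x. s n x - f x)) \<longlonglongrightarrow> 0"
      using complete[of s] s sE unfolding MCauchy_def by meson
    have "\<exists>M. \<forall>n\<ge>M. s n \<in> E \<and> N (\<lambda>x. s n x - f x) < e" if "e > 0" for e
      using LIMSEQ_D[OF f(2) that] sE by auto
    then show "\<exists>f. limitin mtopology s f sequentially"
      unfolding limit_metric_sequentially using f by blast
  qed
  then show ?thesis
    using Banach_fixedpoint_thm[of \<Phi> q] assms that zero_in_E by blast
qed

section \<open>Translation between the operator norm and pointwise bounds\<close>

lemma op_norm_le: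
  assumes "\<And>f. f \<in> E \<Longrightarrow> N f \<le> 1 \<Longrightarrow> T f \<in> E \<and> N (T f) \<le> c"
  shows "op_norm H T \<le> ereal c"
  unfolding op_norm_def by (rule SUP_least) (use assms in auto)

lemma op_norm_nonneg:
  assumes "T (\<lambda>_. 0) \<in> E"
  shows "0 \<le> op_norm H T"
  unfolding op_norm_def
  by (rule SUP_upper2[of "\<lambda>_. 0"]) (use assms in auto)

text \<open>Homogeneity reduces any f to the unit ball, over which \<open>op_norm\<close> is a
  supremum. A finite supremum also forces T to map into \<open>E\<close>, since any other image
  contributes \<infinity>.\<close>

lemma op_norm_bound:
  assumes scale: "\<And>f c. f \<in> E \<Longrightarrow> T (\<lambda>x. c * f x) = (\<lambda>x. c * T f x)"
    and fin: "op_norm H T < \<infinity>" and f: "f \<in> E"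
  shows "T f \<in> E \<and> N (T f) \<le> real_of_ereal (op_norm H T) * N f"
proof -
  have T0: "T (\<lambda>_. 0) = (\<lambda>_. 0)" using scale[OF zero_in_E, of 0] by simp
  have unit: "T g \<in> E \<and> N (T g) \<le> real_of_ereal (op_norm H T)" if "g \<in> E" "N g \<le> 1" for g
  proof -
    have le: "(if T g \<in> E then ereal (N (T g)) else \<infinity>) \<le> op_norm H T"
      unfolding op_norm_def by (rule SUP_upper) (use that in auto)
    with fin have "T g \<in> E" by (auto split: if_splits)
    with le have "ereal (N (T g)) \<le> op_norm H T" by simp
    moreover have "0 \<le> op_norm H T" using op_norm_nonneg T0 by simp
    ultimately show ?thesis using fin \<open>T g \<in> E\<close>
      by (cases "op_norm H T") auto
  qed
  show ?thesis
  proof (cases "N f = 0")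
    case True
    then show ?thesis using N_eq_0[OF f] T0 by simp
  next
    case False
    then have pos: "N f > 0" using N_nonneg[of f] by linarith
    define c where "c = complex_of_real (inverse (N f))"
    have "T (\<lambda>x. c * f x) \<in> E \<and> N (T (\<lambda>x. c * f x)) \<le> real_of_ereal (op_norm H T)"
      by (rule unit) (use f pos in \<open>auto simp: N_scale c_def norm_inverse simp del: of_real_inverse\<close>)
    moreover have "(\<lambda>x. inverse c * T (\<lambda>x. c * f x) x) = T f"
      using pos by (simp add: scale[OF f] c_def fun_eq_iff)
    ultimately show ?thesis
      using scale_in_E[of "T (\<lambda>x. c * f x)" "inverse c"] pos
      by (simp add: scale[OF f] N_scale) (simp add: c_def norm_divide field_simps)
  qed
qed

end

section \<open>Bounded positive operators and their resolvents\<close>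

text \<open>Separation of z from the half line: a negative real z needs no rotation, and a nonreal
  one is rotated by i or -i, which gives \<delta> = |Im z|. Both w and \<delta> depend on z
  alone.\<close>

lemma half_plane:
  assumes "z \<notin> complex_of_real ` {0..}"
  obtains w \<delta> where "cmod w = 1" "0 < \<delta>"
    "\<And>t. 0 \<le> t \<Longrightarrow> \<delta> \<le> Re (w * (complex_of_real t - z))"
proof (cases "Im z = 0")
  case True
  then have z: "z = complex_of_real (Re z)" by (simp add: complex_eq_iff)
  have "\<not> 0 \<le> Re z" using assms by (metis z atLeast_iff imageI)
  then show ?thesis using that[of 1 "- Re z"] by simp
next
  case False
  then show ?thesis
    using that[of "if Im z > 0 then \<i> else - \<i>" "\<bar>Im z\<bar>"] by auto
qed

text \<open>\<open>T_bound\<close> packs positivity and boundedness into one inequality. Graph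
  Laplacians deliver it in this form, and it passes to compressions with the same
  \<open>K\<close>.\<close>

locale positive_operator = mass_space H for H :: "'v wgraph" +
  fixes T :: "('v \<Rightarrow> complex) \<Rightarrow> ('v \<Rightarrow> complex)" and K :: real
  assumes T_in_E [simp]: "f \<in> E \<Longrightarrow> T f \<in> E"
    and T_add: "f \<in> E \<Longrightarrow> g \<in> E \<Longrightarrow> T (\<lambda>x. f x + g x) = (\<lambda>x. T f x + T g x)"
    and T_scale: "f \<in> E \<Longrightarrow> T (\<lambda>x. c * f x) = (\<lambda>x. c * T f x)"
    and T_sym: "f \<in> E \<Longrightarrow> g \<in> E \<Longrightarrow> ip f (T g) = ip (T f) g"
    and T_bound: "f \<in> E \<Longrightarrow> (N (T f))\<^sup>2 \<le> K * Re (ip f (T f))"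
    and K_pos: "0 < K"
begin

lemma T_zero [simp]: "T (\<lambda>_. 0) = (\<lambda>_. 0)"
  using T_scale[of "\<lambda>_. 0" 0] by simp

lemma T_diff: "f \<in> E \<Longrightarrow> g \<in> E \<Longrightarrow> T (\<lambda>x. f x - g x) = (\<lambda>x. T f x - T g x)"
  using T_add[of f "\<lambda>x. - 1 * g x"] T_scale[of g "-1"] by simp

lemma T_pos: "f \<in> E \<Longrightarrow> 0 \<le> Re (ip f (T f))"
  using order_trans[OF zero_le_power2 T_bound[of f]] K_pos by (simp add: zero_le_mult_iff)

lemma T_quad_real: "f \<in> E \<Longrightarrow> ip f (T f) = complex_of_real (Re (ip f (T f)))"
  using T_sym[of f f] ip_cnj[of f "T f"] by (metis Reals_cnj_iff of_real_Re)

lemma T_norm: assumes "f \<in> E" shows "N (T f) \<le> K * N f"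
proof -
  have "(N (T f))\<^sup>2 \<le> K * (N f * N (T f))"
    using T_bound[OF assms] Cauchy_Schwarz[OF assms T_in_E[OF assms]] K_pos
      complex_Re_le_cmod[of "ip f (T f)"]
    by (smt (verit) mult_left_mono)
  then show ?thesis
    using N_nonneg[of "T f"] N_nonneg[of f] K_pos
    by (cases "N (T f) = 0") (auto simp: power2_eq_square)
qed

lemma T_form_Cauchy_Schwarz:
  assumes "f \<in> E" "g \<in> E"
  shows "(cmod (ip f (T g)))\<^sup>2 \<le> Re (ip f (T f)) * Re (ip g (T g))"
proof (rule form_Cauchy_Schwarz[where b = "\<lambda>f g. ip f (T g)"])
  fix f g assume "f \<in> E" "g \<in> E"
  then show "ip g (T f) = cnj (ip f (T g))" using T_sym[of g f] by (simp add: ip_cnj)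
qed (use assms in \<open>auto simp: T_add T_scale ip_simps T_pos\<close>)

lemma shift_in_E [simp]: "f \<in> E \<Longrightarrow> (\<lambda>x. T f x - z * f x) \<in> E"
  by simp

text \<open>Rotating by \<open>w\<close> moves the numerical range of \<open>T - z\<close> into the half plane
  \<open>Re \<ge> \<delta>\<close>.\<close>

lemma shift_coercive:
  assumes w: "cmod w = 1" "\<And>t. 0 \<le> t \<Longrightarrow> \<delta> \<le> Re (w * (complex_of_real t - z))" and f: "f \<in> E"
  shows "\<delta> * (N f)\<^sup>2 \<le> Re (w * ip f (\<lambda>x. T f x - z * f x))"
proof (cases "N f = 0")
  case True
  then have "f = (\<lambda>_. 0)" using N_eq_0[OF f] by simp
  then show ?thesis using ip_scale_right[of "\<lambda>_. 0" 0] by simp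
next
  case False
  then have n: "(N f)\<^sup>2 > 0" by simp
  define t where "t = Re (ip f (T f)) / (N f)\<^sup>2"
  have t: "0 \<le> t" using T_pos[OF f] n by (simp add: t_def)
  have "ip f (\<lambda>x. T f x - z * f x) = complex_of_real ((N f)\<^sup>2) * (complex_of_real t - z)"
  proof -
    have "ip f (T f) = complex_of_real ((N f)\<^sup>2 * t)"
      using T_quad_real[OF f] n by (simp add: t_def)
    then show ?thesis
      using f by (simp add: ip_diff_right ip_scale_right ip_self right_diff_distrib del: of_real_power)
  qed
  then have "Re (w * ip f (\<lambda>x. T f x - z * f x)) = Re (complex_of_real ((N f)\<^sup>2) * (w * (complex_of_real t - z)))"
    by (simp only: mult_ac)
  also have "\<dots> = (N f)\<^sup>2 * Re (w * (complex_of_real t - z))" by (simp del: of_real_power)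
  finally show ?thesis
    using mult_left_mono[OF w(2)[OF t] less_imp_le[OF n]] by (simp only: mult.commute)
qed

lemma shift_lower:
  assumes w: "cmod w = 1" "\<And>t. 0 \<le> t \<Longrightarrow> \<delta> \<le> Re (w * (complex_of_real t - z))" and f: "f \<in> E"
  shows "\<delta> * N f \<le> N (\<lambda>x. T f x - z * f x)"
proof (cases "N f = 0")
  case False
  then have n: "N f > 0" using N_nonneg[of f] by linarith
  have "\<delta> * (N f)\<^sup>2 \<le> cmod (w * ip f (\<lambda>x. T f x - z * f x))"
    using shift_coercive[OF assms] complex_Re_le_cmod order_trans by blast
  also have "\<dots> \<le> N f * N (\<lambda>x. T f x - z * f x)"
    using Cauchy_Schwarz[OF f shift_in_E[OF f]] w(1) by (simp add: norm_mult)
  finally show ?thesis using n by (simp add: power2_eq_square)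
qed simp

text \<open>Lax-Milgram by iteration: coercivity after rotation by w makes a small step u -
  \<epsilon> w ((T - z) u - f) a contraction, and its fixed point solves the equation.\<close>

lemma shift_surj:
  assumes w: "cmod w = 1" "\<And>t. 0 \<le> t \<Longrightarrow> \<delta> \<le> Re (w * (complex_of_real t - z))"
    and \<delta>: "0 < \<delta>" and f: "f \<in> E"
  shows "\<exists>u\<in>E. (\<lambda>x. T u x - z * u x) = f"
proof -
  let ?A = "\<lambda>u x. T u x - z * u x"
  \<comment> \<open>The norm of T - z is at most K + |z|; the extra \<delta> ensures \<delta> < M,
    so that the square root defining \<open>q\<close> has a nonnegative argument.\<close>
  define M where "M = K + cmod z + \<delta>"
  have M: "M > 0" "\<delta> < M" using K_pos \<delta> by (auto simp: M_def add_pos_nonneg)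
  have A_bound: "N (?A u) \<le> M * N u" if u: "u \<in> E" for u
  proof -
    have "N (?A u) \<le> N (T u) + N (\<lambda>x. z * u x)" by (rule N_triangle_diff) (use u in auto)
    also have "\<dots> \<le> K * N u + cmod z * N u" using T_norm[OF u] by (simp add: N_scale)
    also have "\<dots> \<le> M * N u" using \<delta> by (simp add: M_def algebra_simps)
    finally show ?thesis .
  qed
  \<comment> \<open>This step size minimises 1 - 2 \<epsilon> \<delta> + \<epsilon>\<epsilon> M M,
    the bound for the squared contraction factor.\<close>
  define \<epsilon> where "\<epsilon> = \<delta> / M\<^sup>2"
  have \<epsilon>: "\<epsilon> > 0" using \<delta> M by (simp add: \<epsilon>_def)
  define c where "c = complex_of_real \<epsilon> * w"
  define \<Phi> where "\<Phi> u = (\<lambda>x. u x - c * (?A u x - f x))" for u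
  define q where "q = sqrt (1 - \<delta>\<^sup>2 / M\<^sup>2)"
  have q0: "0 \<le> 1 - \<delta>\<^sup>2 / M\<^sup>2"
    using M \<delta> power_mono[of \<delta> M 2] by simp
  have "q < 1" using \<delta> M by (simp add: q_def)
  have contr: "N (\<lambda>x. v x - c * ?A v x) \<le> q * N v" if v: "v \<in> E" for v
  proof (rule power2_le_imp_le)
    have "(N (\<lambda>x. v x - c * ?A v x))\<^sup>2 = (N v)\<^sup>2 - 2 * Re (c * ip v (?A v)) + (\<epsilon> * N (?A v))\<^sup>2"
      using N_diff_sq[OF v scale_in_E[OF shift_in_E[OF v]], of c z] \<epsilon>
      by (simp add: ip_scale_right N_scale c_def norm_mult w(1))
    also have "Re (c * ip v (?A v)) = \<epsilon> * Re (w * ip v (?A v))"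
      unfolding c_def by (simp add: mult.assoc)
    also have "(N v)\<^sup>2 - 2 * (\<epsilon> * Re (w * ip v (?A v))) + (\<epsilon> * N (?A v))\<^sup>2
        \<le> (N v)\<^sup>2 - 2 * (\<epsilon> * (\<delta> * (N v)\<^sup>2)) + (\<epsilon> * (M * N v))\<^sup>2"
      using \<epsilon> by (intro add_mono diff_mono mult_left_mono power_mono shift_coercive[OF w v] A_bound[OF v]) auto
    also have "\<dots> = (1 - \<delta>\<^sup>2 / M\<^sup>2) * (N v)\<^sup>2"
      using M by (simp add: \<epsilon>_def power2_eq_square field_simps)
    also have "\<dots> = (q * N v)\<^sup>2" using q0 by (simp add: q_def power_mult_distrib)
    finally show "(N (\<lambda>x. v x - c * ?A v x))\<^sup>2 \<le> (q * N v)\<^sup>2" .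
    show "0 \<le> q * N v" using q0 by (simp add: q_def)
  qed
  obtain u where u: "u \<in> E" "\<Phi> u = u"
  proof (rule contraction_fixpoint[of \<Phi> q])
    show "\<Phi> u \<in> E" if "u \<in> E" for u
      unfolding \<Phi>_def using that f by (intro diff_in_E scale_in_E shift_in_E)
    fix u v assume uv: "u \<in> E" "v \<in> E"
    have "(\<lambda>x. \<Phi> u x - \<Phi> v x) = (\<lambda>x. (u x - v x) - c * ?A (\<lambda>x. u x - v x) x)"
      using uv by (simp add: \<Phi>_def T_diff algebra_simps)
    then show "N (\<lambda>x. \<Phi> u x - \<Phi> v x) \<le> q * N (\<lambda>x. u x - v x)"
      using contr[of "\<lambda>x. u x - v x"] uv by simp
  qed (use \<open>q < 1\<close> in auto)
  have "c \<noteq> 0" using \<epsilon> w(1) by (auto simp: c_def)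
  have "?A u = f"
    using u(2) \<open>c \<noteq> 0\<close> by (auto simp: \<Phi>_def fun_eq_iff)
  then show ?thesis using u(1) by blast
qed

lemma shift_bij:
  assumes "z \<notin> complex_of_real ` {0..}"
  shows "bij_betw (\<lambda>f x. T f x - z * f x) E E"
proof -
  obtain w \<delta> where w: "cmod w = 1" "0 < \<delta>" "\<And>t. 0 \<le> t \<Longrightarrow> \<delta> \<le> Re (w * (complex_of_real t - z))"
    using half_plane[OF assms] by metis
  have "inj_on (\<lambda>f x. T f x - z * f x) E"
  proof (rule inj_onI)
    fix f g assume fg: "f \<in> E" "g \<in> E" and eq: "(\<lambda>x. T f x - z * f x) = (\<lambda>x. T g x - z * g x)"
    have "(\<lambda>x. T (\<lambda>x. f x - g x) x - z * (f x - g x)) = (\<lambda>_. 0)"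
      using eq fg by (simp add: T_diff fun_eq_iff algebra_simps)
    then have "\<delta> * N (\<lambda>x. f x - g x) \<le> 0"
      using shift_lower[OF w(1,3), of "\<lambda>x. f x - g x"] fg by simp
    then have "N (\<lambda>x. f x - g x) = 0" using w(2) N_nonneg[of "\<lambda>x. f x - g x"]
      by (simp add: mult_le_0_iff order_antisym)
    then show "f = g" using N_eq_0[of "\<lambda>x. f x - g x"] fg by (simp add: fun_eq_iff)
  qed
  moreover have "(\<lambda>f x. T f x - z * f x) ` E = E"
    using shift_surj[OF w(1,3,2)] shift_in_E by (auto simp: image_iff)
  ultimately show ?thesis by (simp add: bij_betw_def)
qed

section \<open>Resolvents and the location of the spectrum\<close>

lemma resolvent_in_E:
  assumes "bij_betw (\<lambda>f x. T f x - z * f x) E E" "f \<in> E"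
  shows "resolvent H T z f \<in> E"
  unfolding resolvent_def using assms by (simp add: bij_betw_imp_surj_on inv_into_into)

lemma shift_resolvent:
  assumes "bij_betw (\<lambda>f x. T f x - z * f x) E E" "f \<in> E"
  shows "T (resolvent H T z f) x - z * resolvent H T z f x = f x"
proof -
  have "(\<lambda>f x. T f x - z * f x) (resolvent H T z f) = f"
    unfolding resolvent_def by (rule bij_betw_inv_into_right[OF assms])
  then show ?thesis by (simp add: fun_eq_iff)
qed

lemma resolvent_unique:
  assumes "bij_betw (\<lambda>f x. T f x - z * f x) E E" "u \<in> E" "\<And>x. T u x - z * u x = f x"
  shows "resolvent H T z f = u"
proof -
  have "f = (\<lambda>f x. T f x - z * f x) u" using assms(3) by (simp add: fun_eq_iff)
  then show ?thesis
    unfolding resolvent_def using bij_betw_inv_into_left[OF assms(1,2)] by simp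
qed

lemma resolvent_scale:
  assumes b: "bij_betw (\<lambda>f x. T f x - z * f x) E E" and f: "f \<in> E"
  shows "resolvent H T z (\<lambda>x. c * f x) = (\<lambda>x. c * resolvent H T z f x)"
proof (rule resolvent_unique[OF b])
  fix x
  show "T (\<lambda>x. c * resolvent H T z f x) x - z * (c * resolvent H T z f x) = c * f x"
    unfolding shift_resolvent[OF b f, of x, symmetric]
    by (simp add: T_scale resolvent_in_E b f algebra_simps)
qed (simp add: resolvent_in_E b f)

lemma resolvent_bound:
  assumes w: "cmod w = 1" "\<And>t. 0 \<le> t \<Longrightarrow> \<delta> \<le> Re (w * (complex_of_real t - z))"
    and b: "bij_betw (\<lambda>f x. T f x - z * f x) E E" and f: "f \<in> E"
  shows "\<delta> * N (resolvent H T z f) \<le> N f"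
  using shift_lower[OF w resolvent_in_E[OF b f]] shift_resolvent[OF b f] by simp

lemma spectrum_nonneg: "spectrum H T \<subseteq> complex_of_real ` {0..}"
proof
  fix z assume z: "z \<in> spectrum H T"
  show "z \<in> complex_of_real ` {0..}"
  proof (rule ccontr)
    assume n: "z \<notin> complex_of_real ` {0..}"
    obtain w \<delta> where w: "cmod w = 1" "0 < \<delta>" "\<And>t. 0 \<le> t \<Longrightarrow> \<delta> \<le> Re (w * (complex_of_real t - z))"
      using half_plane[OF n] by metis
    note b = shift_bij[OF n]
    have "op_norm H (resolvent H T z) \<le> ereal (1 / \<delta>)"
    proof (rule op_norm_le)
      fix f assume f: "f \<in> E" "N f \<le> 1"
      then show "resolvent H T z f \<in> E \<and> N (resolvent H T z f) \<le> 1 / \<delta>"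
        using resolvent_bound[OF w(1,3) b, of f] resolvent_in_E[OF b, of f] w(2)
        by (simp add: field_simps)
    qed
    then have "op_norm H (resolvent H T z) < \<infinity>" by (rule le_less_trans) simp
    with b z show False by (simp add: spectrum_def)
  qed
qed

text \<open>Used contrapositively: where T - z has no lower bound, z is a spectral point.\<close>

lemma bounded_below_off_spectrum:
  assumes "z \<notin> spectrum H T"
  shows "\<exists>c>0. \<forall>f\<in>E. c * N f \<le> N (\<lambda>x. T f x - z * f x)"
proof -
  have b: "bij_betw (\<lambda>f x. T f x - z * f x) E E" and fin: "op_norm H (resolvent H T z) < \<infinity>"
    using assms by (auto simp: spectrum_def)
  define M where "M = real_of_ereal (op_norm H (resolvent H T z))"
  have M: "N u \<le> M * N (\<lambda>x. T u x - z * u x)" if u: "u \<in> E" for u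
  proof -
    have "resolvent H T z (\<lambda>x. T u x - z * u x) = u" by (rule resolvent_unique[OF b u]) simp
    then show ?thesis
      using op_norm_bound[OF resolvent_scale[OF b] fin shift_in_E[OF u], of z] by (simp add: M_def)
  qed
  \<comment> \<open>Adding 1 keeps the divisor positive; M itself is 0 on the trivial space.\<close>
  have "inverse (\<bar>M\<bar> + 1) * N u \<le> N (\<lambda>x. T u x - z * u x)" if u: "u \<in> E" for u
  proof -
    have "N u \<le> (\<bar>M\<bar> + 1) * N (\<lambda>x. T u x - z * u x)"
      by (rule order_trans[OF M[OF u]]) (auto intro!: mult_right_mono)
    then show ?thesis by (simp add: field_simps)
  qed
  then show ?thesis by (intro exI[of _ "inverse (\<bar>M\<bar> + 1)"]) auto
qed

end

section \<open>The spectral gap\<close>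

context positive_operator
begin

text \<open>Symmetry of T - l for real l. It shows that the form of the squared shift is Hermitian
  with diagonal equal to the squared norm of (T - l) f.\<close>

lemma square_shift_form:
  assumes "f \<in> E" "g \<in> E"
  shows "ip (\<lambda>x. T f x - complex_of_real l * f x) (\<lambda>x. T g x - complex_of_real l * g x)
    = ip f (\<lambda>x. T (\<lambda>x. T g x - complex_of_real l * g x) x
                 - complex_of_real l * (T g x - complex_of_real l * g x))"
proof -
  have "ip (\<lambda>x. T f x - complex_of_real l * f x) h
      = ip f (\<lambda>x. T h x - complex_of_real l * h x)" if "h \<in> E" for h
    using assms(1) that T_sym[of f h] by (simp add: ip_simps)
  then show ?thesis using assms(2) by simp
qed

text \<open>Let \<open>l = g / 2\<close> and let \<open>\<mu>\<close> be the infimum of \<open>\<parallel>(T - l) u\<parallel>\<^sup>2\<close> over unit vectors.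
  The nonnegative operator \<open>(T - l)\<^sup>2 - \<mu>\<close> is not bounded below, and it factors into
  \<open>T - (l \<plusminus> \<surd>\<mu>)\<close>; so one of \<open>l \<plusminus> \<surd>\<mu>\<close> is in the spectrum, whence \<open>\<mu> \<ge> l\<^sup>2\<close>.\<close>

lemma gap_square_bound:
  assumes g: "0 < g" and gap: "\<And>r. 0 < r \<Longrightarrow> r < g \<Longrightarrow> complex_of_real r \<notin> spectrum H T"
    and f: "f \<in> E"
  shows "g * Re (ip f (T f)) \<le> (N (T f))\<^sup>2"
proof -
  \<comment> \<open>The midpoint of the spectrum-free interval (0, g); the possible spectral point 0
    lies at distance exactly l from it.\<close>
  define l where "l = g / 2"
  have l: "l > 0" using g by (simp add: l_def)
  define A where "A u = (\<lambda>x. T u x - complex_of_real l * u x)" for u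
  have AE: "A u \<in> E" if "u \<in> E" for u unfolding A_def using that by (rule shift_in_E)
  define S where "S = {(N (A u))\<^sup>2 | u. u \<in> E \<and> N u = 1}"
  have key: "l\<^sup>2 * (N u)\<^sup>2 \<le> (N (A u))\<^sup>2" if u: "u \<in> E" for u
  proof (rule ccontr)
    assume less: "\<not> ?thesis"
    have Nu: "N u > 0"
    proof (rule ccontr)
      assume "\<not> 0 < N u"
      then have "N u = 0" using N_nonneg[of u] by linarith
      with less show False by simp
    qed
    have normalize: "(N (A v))\<^sup>2 / (N v)\<^sup>2 \<in> S" if v: "v \<in> E" "N v > 0" for v
    proof -
      define c where "c = complex_of_real (1 / N v)"
      have c: "cmod c = 1 / N v" using v by (simp add: c_def norm_divide)
      have "A (\<lambda>x. c * v x) = (\<lambda>x. c * A v x)"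
        using v by (simp add: A_def T_scale algebra_simps)
      then have "N (A (\<lambda>x. c * v x)) = N (A v) / N v" "N (\<lambda>x. c * v x) = 1"
        using v by (simp_all add: N_scale c)
      then show ?thesis unfolding S_def using v
        by (auto intro!: exI[of _ "\<lambda>x. c * v x"] simp: power_divide)
    qed
    define \<mu> where "\<mu> = Inf S"
    have bdd: "bdd_below S" unfolding S_def by (auto intro!: bdd_belowI[of _ 0])
    have ne: "S \<noteq> {}" using normalize[OF u Nu] by auto
    have \<mu>0: "0 \<le> \<mu>" unfolding \<mu>_def by (rule cInf_greatest[OF ne]) (auto simp: S_def)
    have \<mu>_le: "\<mu> * (N v)\<^sup>2 \<le> (N (A v))\<^sup>2" if v: "v \<in> E" for v
    proof (cases "N v = 0")
      case False
      then have p: "N v > 0" using N_nonneg[of v] by linarith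
      have "\<mu> \<le> (N (A v))\<^sup>2 / (N v)\<^sup>2"
        unfolding \<mu>_def by (rule cInf_lower[OF normalize[OF v p] bdd])
      then show ?thesis using p by (simp add: field_simps)
    qed simp
    have "\<mu> \<le> (N (A u))\<^sup>2 / (N u)\<^sup>2" unfolding \<mu>_def by (rule cInf_lower[OF normalize[OF u Nu] bdd])
    also have "\<dots> < l\<^sup>2" using less Nu by (simp add: field_simps)
    finally have \<mu>_less: "\<mu> < l\<^sup>2" .
    define s where "s = sqrt \<mu>"
    have s: "0 \<le> s" "s < l" "s\<^sup>2 = \<mu>"
      using \<mu>0 real_sqrt_less_mono[OF \<mu>_less] l by (simp_all add: s_def)
    have s2: "complex_of_real \<mu> = complex_of_real s * complex_of_real s"
      using s(3) by (simp add: power2_eq_square flip: of_real_mult)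
    \<comment> \<open>The strict inequality s < l puts both points inside (0, g), so T minus either
      of them is bounded below.\<close>
    have "complex_of_real (l + s) \<notin> spectrum H T" "complex_of_real (l - s) \<notin> spectrum H T"
      using gap[of "l + s"] gap[of "l - s"] s l by (auto simp: l_def)
    from this[THEN bounded_below_off_spectrum] obtain c1 c2 where c: "0 < c1" "0 < c2"
      and c1: "\<And>f. f \<in> E \<Longrightarrow> c1 * N f \<le> N (\<lambda>x. T f x - complex_of_real (l + s) * f x)"
      and c2: "\<And>f. f \<in> E \<Longrightarrow> c2 * N f \<le> N (\<lambda>x. T f x - complex_of_real (l - s) * f x)"
      by blast
    define B where "B v = (\<lambda>x. A (A v) x - complex_of_real \<mu> * v x)" for v
    have BE: "B v \<in> E" if "v \<in> E" for v unfolding B_def using that by (intro diff_in_E scale_in_E AE)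
    \<comment> \<open>B is the product of T - (l + s) and T - (l - s), hence the lower bounds
      multiply.\<close>
    have B_below: "c1 * c2 * N v \<le> N (B v)" if v: "v \<in> E" for v
    proof -
      let ?w = "\<lambda>x. T v x - complex_of_real (l - s) * v x"
      have w: "?w \<in> E" using v by simp
      have Tw: "T ?w = (\<lambda>x. T (T v) x - complex_of_real (l - s) * T v x)"
        by (simp only: T_diff T_scale v T_in_E scale_in_E)
      have TA: "T (A v) = (\<lambda>x. T (T v) x - complex_of_real l * T v x)"
        by (simp only: A_def T_diff T_scale v T_in_E scale_in_E)
      have "(\<lambda>x. T ?w x - complex_of_real (l + s) * ?w x) = B v"
        unfolding Tw B_def A_def[of "A v"] TA by (simp add: A_def s2 fun_eq_iff algebra_simps)
      then have "c1 * N ?w \<le> N (B v)" using c1[OF w] by simp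
      moreover have "c1 * (c2 * N v) \<le> c1 * N ?w" using c2[OF v] c by simp
      ultimately show ?thesis by (simp add: mult.assoc)
    qed
    define b where "b f h = ip f (B h)" for f h
    have b_eq: "b f h = ip (A f) (A h) - complex_of_real \<mu> * ip f h" if "f \<in> E" "h \<in> E" for f h
      using square_shift_form[OF that, of l] that AE[OF AE[OF that(2)]] unfolding b_def B_def
      by (simp add: ip_diff_right ip_scale_right A_def)
    have b_self: "Re (b f f) = (N (A f))\<^sup>2 - \<mu> * (N f)\<^sup>2" if "f \<in> E" for f
      using that by (simp add: b_eq ip_self flip: of_real_power of_real_mult)
    define M where "M = K + l"
    have A_bound: "N (A v) \<le> M * N v" if v: "v \<in> E" for v
    proof -
      have "N (A v) \<le> N (T v) + N (\<lambda>x. complex_of_real l * v x)"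
        unfolding A_def by (rule N_triangle_diff) (use v in auto)
      also have "\<dots> \<le> K * N v + l * N v" using T_norm[OF v] l by (simp add: N_scale)
      finally show ?thesis by (simp add: M_def algebra_simps)
    qed
    have M: "M > 0" using K_pos l by (simp add: M_def)
    \<comment> \<open>A positive operator that is bounded below has a form bounded below:
      Cauchy-Schwarz for b at v and B v bounds the fourth power of |B v| by b(v, v) times the square
      of M |B v|. Cancelling the square of |B v| leaves a positive lower bound for b(v, v).\<close>
    have lower: "(c1 * c2)\<^sup>2 / M\<^sup>2 \<le> (N (A v))\<^sup>2 - \<mu>" if v: "v \<in> E" "N v = 1" for v
    proof -
      have Bv: "B v \<in> E" "N (B v) > 0"
        using BE[OF v(1)] less_le_trans[OF mult_pos_pos[OF c], of "N (B v)"] B_below[OF v(1)] v(2)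
        by auto
      have "(cmod (b v (B v)))\<^sup>2 \<le> Re (b v v) * Re (b (B v) (B v))"
      proof (rule form_Cauchy_Schwarz)
        show "b f (\<lambda>x. g x + h x) = b f g + b f h" if "f \<in> E" "g \<in> E" "h \<in> E" for f g h
          using that AE by (simp add: b_eq ip_add_right algebra_simps)
             (simp add: A_def T_add algebra_simps flip: ip_add_right)
        show "b f (\<lambda>x. c * h x) = c * b f h" if "f \<in> E" "h \<in> E" for f h c
        proof -
          have "A (\<lambda>x. c * h x) = (\<lambda>x. c * A h x)" using that by (simp add: A_def T_scale algebra_simps)
          then show ?thesis using that by (simp add: b_eq ip_scale_right algebra_simps)
        qed
        show "b h f = cnj (b f h)" if "f \<in> E" "h \<in> E" for f h
          using that by (simp add: b_eq ip_cnj)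
        show "0 \<le> Re (b f f)" if "f \<in> E" for f
          using \<mu>_le[OF that] by (simp add: b_self[OF that])
      qed (use v Bv in auto)
      also have "Re (b (B v) (B v)) \<le> (N (A (B v)))\<^sup>2"
        using \<mu>0 by (simp add: b_self[OF Bv(1)])
      also have "(N (A (B v)))\<^sup>2 \<le> (M * N (B v))\<^sup>2"
        using A_bound[OF Bv(1)] by (intro power_mono) auto
      finally have "(cmod (b v (B v)))\<^sup>2 \<le> Re (b v v) * (M * N (B v))\<^sup>2"
        using \<mu>_le[OF v(1)] by (simp add: b_self[OF v(1)] mult_left_mono)
      moreover have "b v (B v) = cnj (ip (B v) (B v))"
        unfolding b_def[of "B v" v, symmetric] using v Bv by (simp add: b_eq ip_cnj)
      ultimately have "((N (B v))\<^sup>2)\<^sup>2 \<le> Re (b v v) * (M * N (B v))\<^sup>2"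
        by (simp add: ip_self norm_power)
      then have "(N (B v))\<^sup>2 * (N (B v))\<^sup>2 \<le> (Re (b v v) * M\<^sup>2) * (N (B v))\<^sup>2"
        by (simp add: power2_eq_square mult_ac)
      then have "(N (B v))\<^sup>2 \<le> Re (b v v) * M\<^sup>2"
        by (rule mult_right_le_imp_le) (use Bv(2) in simp)
      moreover have "(c1 * c2)\<^sup>2 \<le> (N (B v))\<^sup>2"
        using B_below[OF v(1)] v(2) c by (intro power_mono) auto
      ultimately show ?thesis using M v(2) by (simp add: b_self[OF v(1)] field_simps)
    qed
    \<comment> \<open>The uniform surplus gives \<open>S\<close> a lower bound that exceeds its
      infimum.\<close>
    have "\<mu> + (c1 * c2)\<^sup>2 / M\<^sup>2 \<le> \<mu>"
      unfolding \<mu>_def[symmetric] by (subst (2) \<mu>_def, rule cInf_greatest[OF ne]) (use lower in \<open>force simp: S_def\<close>)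
    then show False using c M by (simp add: divide_le_0_iff mult_le_0_iff zero_less_power not_le)
  qed
  \<comment> \<open>Expanding the square, the terms l l |f| |f| cancel against \<open>key\<close>,
    and 2 l = g remains.\<close>
  have "(N (A f))\<^sup>2 = (N (T f))\<^sup>2 - 2 * (l * Re (ip f (T f))) + (l * N f)\<^sup>2"
    using N_diff_sq[of "T f" "\<lambda>x. complex_of_real l * f x"] f l
    by (simp add: A_def ip_scale_right N_scale ip_swap_Re[of "T f" f])
  then have "2 * l * Re (ip f (T f)) \<le> (N (T f))\<^sup>2"
    using key[OF f] by (simp add: power_mult_distrib)
  then show ?thesis by (simp add: l_def)
qed

text \<open>Cauchy-Schwarz in the form of T at y and T y bounds the fourth power of |T y| by the
  product of the form values at y and at T y. \<open>gap_square_bound\<close> controls the first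
  value by 1 / g times the square of |T y|, and the second is at most |T y| |T T y|.\<close>

lemma gap_on_range:
  assumes g: "0 < g" and gap: "\<And>r. 0 < r \<Longrightarrow> r < g \<Longrightarrow> complex_of_real r \<notin> spectrum H T"
    and y: "y \<in> E"
  shows "g * N (T y) \<le> N (T (T y))"
proof (cases "N (T y) = 0")
  case False
  then have p: "N (T y) > 0" using N_nonneg[of "T y"] by linarith
  let ?v = "T y"
  have v: "?v \<in> E" using y by simp
  have "(cmod (ip y (T ?v)))\<^sup>2 \<le> Re (ip y ?v) * Re (ip ?v (T ?v))"
    by (rule T_form_Cauchy_Schwarz[OF y v])
  also have "ip y (T ?v) = complex_of_real ((N ?v)\<^sup>2)"
    using T_sym[OF y v] by (simp add: ip_self)
  also have "Re (ip y ?v) * Re (ip ?v (T ?v)) \<le> (N ?v)\<^sup>2 / g * (N ?v * N (T ?v))"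
  proof (rule mult_mono)
    show "Re (ip y ?v) \<le> (N ?v)\<^sup>2 / g"
      using gap_square_bound[OF g gap y] g by (simp add: field_simps)
    show "Re (ip ?v (T ?v)) \<le> N ?v * N (T ?v)"
      using Cauchy_Schwarz[OF v T_in_E[OF v]] complex_Re_le_cmod order_trans by blast
  qed (use g T_pos[OF v] in auto)
  finally have "((N ?v)\<^sup>2)\<^sup>2 \<le> (N ?v)\<^sup>2 / g * (N ?v * N (T ?v))"
    by (simp add: norm_power)
  then have "(N ?v)\<^sup>2 * (N ?v * (g * N ?v)) \<le> (N ?v)\<^sup>2 * (N ?v * N (T ?v))"
    using g by (simp add: field_simps power2_eq_square)
  then show ?thesis using p by simp
qed simp

text \<open>A vector \<open>w\<close> orthogonal to the kernel is the limit of the range vectors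
  \<open>T (T + \<epsilon>)\<^sup>-\<^sup>1 w\<close>, which converge because of the lower bound on the range.\<close>

lemma gap_orthogonal_kernel:
  assumes g: "0 < g" and gap: "\<And>r. 0 < r \<Longrightarrow> r < g \<Longrightarrow> complex_of_real r \<notin> spectrum H T"
    and w: "w \<in> E" and orth: "\<And>k. k \<in> E \<Longrightarrow> T k = (\<lambda>_. 0) \<Longrightarrow> ip k w = 0"
  shows "g * N w \<le> N (T w)"
proof -
  define e where "e n = 1 / real (Suc n)" for n
  have e: "e n > 0" for n by (simp add: e_def)
  have e0: "e \<longlonglongrightarrow> 0" unfolding e_def by (rule LIMSEQ_Suc[OF lim_1_over_n])
  have bij: "bij_betw (\<lambda>f x. T f x - (- complex_of_real (e n)) * f x) E E" for n
    by (rule shift_bij) (use e[of n] in \<open>auto simp: complex_eq_iff\<close>)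
  define y where "y n = resolvent H T (- complex_of_real (e n)) w" for n
  have y: "y n \<in> E" for n unfolding y_def by (rule resolvent_in_E[OF bij w])
  have w_eq: "w = (\<lambda>x. T (y n) x + complex_of_real (e n) * y n x)" for n
    using shift_resolvent[OF bij[of n] w] by (simp add: y_def fun_eq_iff)
  define v where "v n = T (y n)" for n
  have v: "v n \<in> E" for n by (simp add: v_def y)
  have v_le: "N (v n) \<le> N w" for n
  proof (rule power2_le_imp_le)
    have "(N w)\<^sup>2 = (N (v n))\<^sup>2 + 2 * (e n * Re (ip (y n) (T (y n)))) + (e n * N (y n))\<^sup>2"
      using e[of n] by (subst w_eq[of n], subst N_add_sq)
        (simp_all add: y v_def ip_scale_right N_scale ip_swap_Re[of "T _" "y n"])
    then show "(N (v n))\<^sup>2 \<le> (N w)\<^sup>2" using T_pos[OF y[of n]] e[of n] by simp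
  qed simp
  have Tw: "T w = (\<lambda>x. T (v n) x + complex_of_real (e n) * v n x)" for n
    by (subst w_eq[of n]) (simp add: T_add T_scale y v_def)
  \<comment> \<open>The difference lies in the range of T, where the gap estimate is available,
    while T maps it to a combination with coefficients \<open>e m\<close> and \<open>e n\<close>. So
    the approximants are Cauchy.\<close>
  have diff: "g * N (\<lambda>x. v m x - v n x) \<le> (e m + e n) * N w" for m n
  proof -
    have "(\<lambda>x. v m x - v n x) = T (\<lambda>x. y m x - y n x)" by (simp add: v_def T_diff y)
    then have "g * N (\<lambda>x. v m x - v n x) \<le> N (T (\<lambda>x. v m x - v n x))"
      using gap_on_range[OF g gap, of "\<lambda>x. y m x - y n x"] y by simp
    also have "T (\<lambda>x. v m x - v n x) = (\<lambda>x. complex_of_real (e n) * v n x - complex_of_real (e m) * v m x)"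
      using Tw[of m] Tw[of n] by (simp add: T_diff v fun_eq_iff algebra_simps)
    also have "N \<dots> \<le> e n * N (v n) + e m * N (v m)"
      by (rule order_trans[OF N_triangle_diff]) (use v e[of n] e[of m] in \<open>auto simp: N_scale\<close>)
    also have "\<dots> \<le> e n * N w + e m * N w"
      using v_le e by (intro add_mono mult_left_mono) (auto intro: less_imp_le)
    finally show ?thesis by (simp add: algebra_simps)
  qed
  have "\<exists>f\<in>E. (\<lambda>n. N (\<lambda>x. v n x - f x)) \<longlonglongrightarrow> 0"
  proof (rule complete[OF v])
    fix d :: real assume d: "d > 0"
    have "(\<lambda>n. e n * N w) \<longlonglongrightarrow> 0" using tendsto_mult_right[OF e0] by simp
    then obtain M where M: "\<And>n. n \<ge> M \<Longrightarrow> e n * N w < g * d / 2"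
      using order_tendstoD(2)[of "\<lambda>n. e n * N w" 0 sequentially "g * d / 2"] d g
      by (auto simp: eventually_sequentially)
    have "N (\<lambda>x. v m x - v n x) < d" if "m \<ge> M" "n \<ge> M" for m n
    proof -
      have "g * N (\<lambda>x. v m x - v n x) < g * d"
        using diff[of m n] M[OF that(1)] M[OF that(2)] by (simp add: algebra_simps)
      then show ?thesis using g by simp
    qed
    then show "\<exists>M. \<forall>m\<ge>M. \<forall>n\<ge>M. N (\<lambda>x. v m x - v n x) < d" by blast
  qed
  then obtain f where f: "f \<in> E" and lim: "(\<lambda>n. N (\<lambda>x. v n x - f x)) \<longlonglongrightarrow> 0" by blast
  let ?k = "\<lambda>x. w x - f x"
  \<comment> \<open>Since T w - T (v n) = e n v n tends to 0, the remainder w - f lies in the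
    kernel.\<close>
  have "N (T ?k) \<le> 0"
  proof (rule LIMSEQ_le_const)
    show "(\<lambda>n. e n * N w + K * N (\<lambda>x. v n x - f x)) \<longlonglongrightarrow> 0"
      using tendsto_add[OF tendsto_mult_right[OF e0, of "N w"] tendsto_mult_left[OF lim, of K]] by simp
    have "N (T ?k) \<le> e n * N w + K * N (\<lambda>x. v n x - f x)" for n
    proof -
      have "T ?k = (\<lambda>x. complex_of_real (e n) * v n x + T (\<lambda>x. v n x - f x) x)"
        using Tw[of n] by (simp add: T_diff v w f algebra_simps)
      then have "N (T ?k) \<le> N (\<lambda>x. complex_of_real (e n) * v n x) + N (T (\<lambda>x. v n x - f x))"
        using N_triangle[of "\<lambda>x. complex_of_real (e n) * v n x" "T (\<lambda>x. v n x - f x)"] v f by simp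
      also have "\<dots> \<le> e n * N w + K * N (\<lambda>x. v n x - f x)"
        using T_norm[of "\<lambda>x. v n x - f x"] v f v_le[of n] e[of n] by (simp add: N_scale add_mono)
      finally show ?thesis .
    qed
    then show "\<exists>M. \<forall>n\<ge>M. N (T ?k) \<le> e n * N w + K * N (\<lambda>x. v n x - f x)" by blast
  qed
  then have Tk: "T ?k = (\<lambda>_. 0)" using N_eq_0[of "T ?k"] N_nonneg[of "T ?k"] w f by simp
  \<comment> \<open>As a limit of range vectors f is orthogonal to the kernel. So is w, hence w - f
    is orthogonal to itself.\<close>
  have "cmod (ip ?k f) \<le> 0"
  proof (rule LIMSEQ_le_const)
    show "(\<lambda>n. N ?k * N (\<lambda>x. v n x - f x)) \<longlonglongrightarrow> 0"
      using tendsto_mult_left[OF lim, of "N ?k"] by simp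
    have "cmod (ip ?k f) \<le> N ?k * N (\<lambda>x. v n x - f x)" for n
    proof -
      have "ip ?k (v n) = 0"
        using T_sym[of ?k "y n"] Tk w f y by (simp add: v_def ell2_inner_def)
      then have "cmod (ip ?k f) = cmod (ip ?k (\<lambda>x. v n x - f x))"
        using w f v by (simp add: ip_diff_right)
      then show ?thesis using Cauchy_Schwarz[of ?k "\<lambda>x. v n x - f x"] w f v by simp
    qed
    then show "\<exists>M. \<forall>n\<ge>M. cmod (ip ?k f) \<le> N ?k * N (\<lambda>x. v n x - f x)" by blast
  qed
  then have "ip ?k ?k = 0" using orth[OF _ Tk] w f by (simp add: ip_diff_right)
  then have "N ?k = 0" by (simp add: ip_self)
  then have wf: "w = f" using N_eq_0[of ?k] w f by (simp add: fun_eq_iff)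
  show ?thesis
  proof (rule LIMSEQ_le_const)
    show "(\<lambda>n. N (T w) + (K + g) * N (\<lambda>x. v n x - f x)) \<longlonglongrightarrow> N (T w)"
      using tendsto_add[OF tendsto_const tendsto_mult_left[OF lim, of "K + g"]] by simp
    have "g * N w \<le> N (T w) + (K + g) * N (\<lambda>x. v n x - f x)" for n
    proof -
      let ?d = "\<lambda>x. v n x - f x"
      have "w = (\<lambda>x. v n x - ?d x)" by (simp add: wf)
      then have "N w \<le> N (v n) + N ?d" using N_triangle_diff[of "v n" ?d] v f by simp
      then have "g * N w \<le> g * N (v n) + g * N ?d"
        using mult_left_mono[of "N w" "N (v n) + N ?d" g] g by (simp add: distrib_left)
      moreover have "g * N (v n) \<le> N (T (v n))"
        unfolding v_def by (rule gap_on_range[OF g gap y])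
      moreover have "T (v n) = (\<lambda>x. T w x + T ?d x)" by (simp add: wf T_diff v f)
      then have "N (T (v n)) \<le> N (T w) + K * N ?d"
        using N_triangle[of "T w" "T ?d"] T_norm[of ?d] v f w by simp
      ultimately show ?thesis by (simp add: algebra_simps)
    qed
    then show "\<exists>M. \<forall>n\<ge>M. g * N w \<le> N (T w) + (K + g) * N (\<lambda>x. v n x - f x)" by blast
  qed
qed

end

section \<open>The projection onto the kernel and the reduced resolvent\<close>

locale kernel_projection = positive_operator H T K for H :: "'v wgraph" and T K +
  fixes P :: "('v \<Rightarrow> complex) \<Rightarrow> ('v \<Rightarrow> complex)"
  assumes P_in_E [simp]: "f \<in> E \<Longrightarrow> P f \<in> E"
    and P_kernel: "f \<in> E \<Longrightarrow> T (P f) = (\<lambda>_. 0)"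
    and P_orth: "f \<in> E \<Longrightarrow> k \<in> E \<Longrightarrow> T k = (\<lambda>_. 0) \<Longrightarrow> ip k (\<lambda>x. f x - P f x) = 0"
    and P_scale: "f \<in> E \<Longrightarrow> P (\<lambda>x. c * f x) = (\<lambda>x. c * P f x)"
begin

lemma Pythagoras:
  assumes f: "f \<in> E"
  shows "(N f)\<^sup>2 = (N (P f))\<^sup>2 + (N (\<lambda>x. f x - P f x))\<^sup>2"
  using N_add_sq[of "P f" "\<lambda>x. f x - P f x"] P_orth[OF f P_in_E[OF f] P_kernel[OF f]] f by simp

lemma N_P: assumes "f \<in> E" shows "N (P f) \<le> N f"
  by (rule power2_le_imp_le) (use Pythagoras[OF assms] in auto)

lemma N_coP: assumes "f \<in> E" shows "N (\<lambda>x. f x - P f x) \<le> N f"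
  by (rule power2_le_imp_le) (use Pythagoras[OF assms] in auto)

text \<open>The resolvent restricted to the orthogonal complement of the kernel: on the kernel
  itself T - z is multiplication by -z, and the two terms cancel.\<close>

definition reduced_resolvent :: "complex \<Rightarrow> ('v \<Rightarrow> complex) \<Rightarrow> 'v \<Rightarrow> complex" where
  "reduced_resolvent z h = (\<lambda>x. resolvent H T z h x - P h x / (- z))"

context
  fixes z
  assumes z: "z \<notin> complex_of_real ` {0..}"
begin

lemma z_nonzero: "z \<noteq> 0"
  using z by force

lemma reduced_resolvent_in_E [simp]: "h \<in> E \<Longrightarrow> reduced_resolvent z h \<in> E"
  unfolding reduced_resolvent_def by (intro diff_in_E divide_in_E P_in_E resolvent_in_E[OF shift_bij[OF z]])

lemma reduced_resolvent_scale:
  "h \<in> E \<Longrightarrow> reduced_resolvent z (\<lambda>x. c * h x) = (\<lambda>x. c * reduced_resolvent z h x)"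
  by (simp add: reduced_resolvent_def P_scale resolvent_scale[OF shift_bij[OF z]] algebra_simps)

context
  fixes w \<delta>
  assumes w: "cmod w = 1" "\<And>t. 0 \<le> t \<Longrightarrow> \<delta> \<le> Re (w * (complex_of_real t - z))" and \<delta>: "0 < \<delta>"
begin

text \<open>A crude bound, wanted only for finiteness, so that the norm may be handled as a real
  number when the resolvents are compared.\<close>

lemma reduced_resolvent_op_norm_finite: "op_norm H (reduced_resolvent z) < \<infinity>"
proof -
  have "op_norm H (reduced_resolvent z) \<le> ereal (1 / \<delta> + 1 / cmod z)"
  proof (rule op_norm_le)
    fix f assume f: "f \<in> E" "N f \<le> 1"
    let ?r = "resolvent H T z f"
    have r: "?r \<in> E" by (rule resolvent_in_E[OF shift_bij[OF z] f(1)])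
    have "N ?r \<le> 1 / \<delta>"
      using resolvent_bound[OF w shift_bij[OF z] f(1)] f(2) \<delta> by (simp add: field_simps)
    moreover have "N (\<lambda>x. P f x / (- z)) \<le> 1 / cmod z"
      using N_scale[of "inverse (- z)" "P f"] N_P[OF f(1)] f(2)
      by (simp add: divide_inverse mult.commute norm_inverse mult_left_le)
    ultimately have "N (reduced_resolvent z f) \<le> 1 / \<delta> + 1 / cmod z"
      using N_triangle_diff[OF r divide_in_E[OF P_in_E[OF f(1)]], of "- z"]
      unfolding reduced_resolvent_def by linarith
    then show "reduced_resolvent z f \<in> E \<and> N (reduced_resolvent z f) \<le> 1 / \<delta> + 1 / cmod z"
      using f by simp
  qed
  then show ?thesis by (rule le_less_trans) simp
qed

text \<open>The vector u = X h is orthogonal to the kernel and solves (T - z) u = h - P h. The gap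
  bounds g |u| by |T u|, and coercivity bounds the leftover |z| |u|.\<close>

lemma reduced_resolvent_gap_bound:
  assumes g: "0 < g" and gap: "\<And>r. 0 < r \<Longrightarrow> r < g \<Longrightarrow> complex_of_real r \<notin> spectrum H T"
    and h: "h \<in> E"
  shows "g * N (reduced_resolvent z h) \<le> (1 + cmod z / \<delta>) * N h"
proof -
  let ?u = "reduced_resolvent z h" and ?q = "\<lambda>x. h x - P h x"
  have r: "resolvent H T z h \<in> E" by (rule resolvent_in_E[OF shift_bij[OF z] h])
  have u: "?u \<in> E" using h by simp
  have "T ?u = (\<lambda>x. T (resolvent H T z h) x - T (\<lambda>x. inverse (- z) * P h x) x)"
    unfolding reduced_resolvent_def using r h
    by (subst T_diff[symmetric]) (simp_all add: divide_inverse mult.commute)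
  then have Tu: "T ?u = T (resolvent H T z h)"
    using h by (simp add: T_scale P_kernel del: inverse_minus_eq)
  have eq: "(\<lambda>x. T ?u x - z * ?u x) = ?q"
    unfolding Tu using shift_resolvent[OF shift_bij[OF z] h] z_nonzero
    by (simp add: reduced_resolvent_def fun_eq_iff right_diff_distrib algebra_simps)
  have "g * N ?u \<le> N (T ?u)"
  proof (rule gap_orthogonal_kernel[OF g gap u])
    fix k assume k: "k \<in> E" "T k = (\<lambda>_. 0)"
    have "ip k (T ?u) = 0" using T_sym[OF k(1) u] k(2) by (simp add: ell2_inner_def)
    then have "- z * ip k ?u = ip k (\<lambda>x. T ?u x - z * ?u x)"
      using k u by (simp add: ip_diff_right ip_scale_right)
    also have "\<dots> = 0" unfolding eq by (rule P_orth[OF h k])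
    finally show "ip k ?u = 0" using z_nonzero by simp
  qed
  also have "T ?u = (\<lambda>x. ?q x + z * ?u x)" using eq by (simp add: fun_eq_iff algebra_simps)
  also have "N \<dots> \<le> N ?q + cmod z * N ?u"
    using N_triangle[of ?q "\<lambda>x. z * ?u x"] h u by (simp add: N_scale)
  also have "\<dots> \<le> N h + cmod z * (N h / \<delta>)"
  proof (intro add_mono mult_left_mono)
    have "\<delta> * N ?u \<le> N ?q" using shift_lower[OF w u] unfolding eq .
    also have "\<dots> \<le> N h" by (rule N_coP[OF h])
    finally show "N ?u \<le> N h / \<delta>" using \<delta> by (simp add: field_simps)
  qed (auto intro: N_coP[OF h])
  finally show ?thesis by (simp add: algebra_simps)
qed

lemma reduced_resolvent_op_norm_gap:
  "op_norm H (reduced_resolvent z) \<le> ereal (1 + cmod z / \<delta>) * (1 / spectral_gap H T)"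
proof -
  let ?c = "1 + cmod z / \<delta>" and ?gap = "spectral_gap H T"
  have c: "?c > 0" using \<delta> by (simp add: add_pos_nonneg)
  \<comment> \<open>Stated for every real g below the gap, because the gap itself may be
    infinite.\<close>
  have bound: "op_norm H (reduced_resolvent z) \<le> ereal (?c / g)" if g: "0 < g" "ereal g \<le> ?gap" for g
  proof (rule op_norm_le)
    fix h assume h: "h \<in> E" "N h \<le> 1"
    have gap: "complex_of_real r \<notin> spectrum H T" if "0 < r" "r < g" for r
    proof
      assume "complex_of_real r \<in> spectrum H T"
      then have "?gap \<le> ereal r" unfolding spectral_gap_def using that by (intro Inf_lower) auto
      with g(2) have "ereal g \<le> ereal r" by (rule order_trans)
      with that show False by simp
    qed
    have "g * N (reduced_resolvent z h) \<le> ?c"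
      using order_trans[OF reduced_resolvent_gap_bound[OF g(1) gap h(1)]
          mult_left_mono[OF h(2) less_imp_le[OF c]]] by simp
    then show "reduced_resolvent z h \<in> E \<and> N (reduced_resolvent z h) \<le> ?c / g"
      using h g by (simp add: field_simps)
  qed
  have nonneg: "0 \<le> ?gap"
    unfolding spectral_gap_def
    by (rule Inf_greatest) (use spectrum_nonneg in fastforce)
  show ?thesis
  proof (cases ?gap)
    case (real g)
    show ?thesis
    proof (cases "g = 0")
      \<comment> \<open>With a vanishing gap the right side is \<infinity>, by
        \<open>1 / 0 = \<infinity>\<close> and positivity of the constant.\<close>
      case True
      then show ?thesis using real c by (simp add: zero_ereal_def[symmetric] divide_ereal_def)
    next
      case False
      then have "op_norm H (reduced_resolvent z) \<le> ereal (?c / g)" using bound[of g] real nonneg by simp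
      also have "ereal (?c / g) = ereal ?c * (1 / ?gap)"
        using real False by (simp add: one_ereal_def)
      finally show ?thesis .
    qed
  next
    case PInf
    \<comment> \<open>With an infinite gap every g > 0 is admissible; g = \<open>?c / d\<close>
      brings the bound down to d.\<close>
    have "op_norm H (reduced_resolvent z) \<le> ereal 0"
    proof (rule ereal_le_epsilon2)
      fix d :: real assume d: "0 < d"
      then have "op_norm H (reduced_resolvent z) \<le> ereal (?c / (?c / d))"
        using c PInf by (intro bound) auto
      then show "op_norm H (reduced_resolvent z) \<le> ereal 0 + ereal d" using c by simp
    qed
    then show ?thesis using PInf by (simp add: zero_ereal_def[symmetric])
  qed (use nonneg in auto)
qed

end
end
end

section \<open>Comparison of resolvents\<close>

lemma positive_operator_cong:
  assumes "positive_operator H T K" "\<And>f. f \<in> ell2 H \<Longrightarrow> T' f = T f"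
  shows "positive_operator H T' K"
proof -
  interpret positive_operator H T K by fact
  show ?thesis
    by unfold_locales (auto simp: assms(2) T_add T_scale K_pos intro: T_sym T_bound)
qed

text \<open>\<open>Ju\<close> embeds isometrically, \<open>Jd\<close> is its adjoint, and
  \<open>Ju\<close> after \<open>Jd\<close> projects orthogonally onto the range of
  \<open>Ju\<close>. Graphs enter only as carriers of mass, so the comparison of resolvents becomes
  a statement on abstract operators.\<close>

locale ell2_isometry = up: mass_space H + down: mass_space H'
  for H :: "'v wgraph" and H' :: "'w wgraph" +
  fixes Ju :: "('w \<Rightarrow> complex) \<Rightarrow> ('v \<Rightarrow> complex)" and Jd :: "('v \<Rightarrow> complex) \<Rightarrow> ('w \<Rightarrow> complex)"
  assumes Ju_in_E [simp]: "g \<in> down.E \<Longrightarrow> Ju g \<in> up.E"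
    and Jd_in_E [simp]: "f \<in> up.E \<Longrightarrow> Jd f \<in> down.E"
    and Ju_add: "g \<in> down.E \<Longrightarrow> h \<in> down.E \<Longrightarrow> Ju (\<lambda>x. g x + h x) = (\<lambda>x. Ju g x + Ju h x)"
    and Ju_scale: "g \<in> down.E \<Longrightarrow> Ju (\<lambda>x. c * g x) = (\<lambda>x. c * Ju g x)"
    and Jd_add: "f \<in> up.E \<Longrightarrow> k \<in> up.E \<Longrightarrow> Jd (\<lambda>x. f x + k x) = (\<lambda>x. Jd f x + Jd k x)"
    and Jd_scale: "f \<in> up.E \<Longrightarrow> Jd (\<lambda>x. c * f x) = (\<lambda>x. c * Jd f x)"
    and adjoint: "g \<in> down.E \<Longrightarrow> f \<in> up.E \<Longrightarrow> down.ip g (Jd f) = up.ip (Ju g) f"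
    and Jd_Ju [simp]: "g \<in> down.E \<Longrightarrow> Jd (Ju g) = g"
begin

lemma adjoint': "g \<in> down.E \<Longrightarrow> f \<in> up.E \<Longrightarrow> down.ip (Jd f) g = up.ip f (Ju g)"
  using adjoint[of g f] down.ip_cnj[of g "Jd f"] up.ip_cnj[of "Ju g" f] by simp

lemma Jd_diff: "f \<in> up.E \<Longrightarrow> h \<in> up.E \<Longrightarrow> Jd (\<lambda>x. f x - h x) = (\<lambda>x. Jd f x - Jd h x)"
  using Jd_add[of f "\<lambda>x. - 1 * h x"] Jd_scale[of h "-1"] by simp

lemma N_Ju:
  assumes "g \<in> down.E"
  shows "up.N (Ju g) = down.N g"
proof -
  have "complex_of_real ((up.N (Ju g))\<^sup>2) = complex_of_real ((down.N g)\<^sup>2)"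
    using adjoint[of g "Ju g"] assms by (simp only: up.ip_self[symmetric] down.ip_self[symmetric] Jd_Ju Ju_in_E)
  then have "(up.N (Ju g))\<^sup>2 = (down.N g)\<^sup>2" unfolding of_real_eq_iff .
  then show ?thesis by (simp add: power2_eq_iff_nonneg)
qed

lemma N_Jd:
  assumes "f \<in> up.E"
  shows "down.N (Jd f) \<le> up.N f"
proof (cases "down.N (Jd f) = 0")
  case False
  then have p: "down.N (Jd f) > 0" using down.N_nonneg[of "Jd f"] by linarith
  have "up.ip (Ju (Jd f)) f = complex_of_real ((down.N (Jd f))\<^sup>2)"
    using adjoint[of "Jd f" f] assms by (simp add: down.ip_self)
  then have "(down.N (Jd f))\<^sup>2 = cmod (up.ip (Ju (Jd f)) f)"
    by (simp add: norm_power)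
  also have "\<dots> \<le> down.N (Jd f) * up.N f"
    using up.Cauchy_Schwarz[of "Ju (Jd f)" f] assms by (simp add: N_Ju)
  finally show ?thesis using p by (simp add: power2_eq_square)
qed simp

text \<open>\<open>K\<close> survives because \<open>Jd\<close> is a contraction and, by
  adjointness, the compressed form at g is the form of R at \<open>Ju g\<close>.\<close>

lemma compression:
  assumes "positive_operator H R K"
  shows "positive_operator H' (\<lambda>g. Jd (R (Ju g))) K"
proof -
  interpret R: positive_operator H R K by fact
  show ?thesis
  proof
    fix g h c assume g: "g \<in> down.E"
    show "Jd (R (Ju g)) \<in> down.E" using g by simp
    show "Jd (R (Ju (\<lambda>x. c * g x))) = (\<lambda>x. c * Jd (R (Ju g)) x)"
      using g by (simp add: Ju_scale R.T_scale Jd_scale)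
    have "(down.N (Jd (R (Ju g))))\<^sup>2 \<le> (up.N (R (Ju g)))\<^sup>2"
      using g by (intro power_mono N_Jd) auto
    also have "\<dots> \<le> K * Re (up.ip (Ju g) (R (Ju g)))" using g by (intro R.T_bound) simp
    finally show "(down.N (Jd (R (Ju g))))\<^sup>2 \<le> K * Re (down.ip g (Jd (R (Ju g))))"
      using g by (simp add: adjoint)
    assume h: "h \<in> down.E"
    show "Jd (R (Ju (\<lambda>x. g x + h x))) = (\<lambda>x. Jd (R (Ju g)) x + Jd (R (Ju h)) x)"
      using g h by (simp add: Ju_add R.T_add Jd_add)
    show "down.ip g (Jd (R (Ju h))) = down.ip (Jd (R (Ju g))) h"
      using g h by (simp add: adjoint adjoint' R.T_sym)
  qed (rule R.K_pos)
qed

lemma kernel_projectionI: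
  assumes S: "positive_operator H S K"
    and kernel: "\<And>f. f \<in> up.E \<Longrightarrow> S f = (\<lambda>_. 0) \<longleftrightarrow> Ju (Jd f) = f"
  shows "kernel_projection H S K (\<lambda>f. Ju (Jd f))"
proof -
  interpret S: positive_operator H S K by fact
  show ?thesis
  proof
    fix f k c assume f: "f \<in> up.E"
    show "Ju (Jd f) \<in> up.E" using f by simp
    show "S (Ju (Jd f)) = (\<lambda>_. 0)" using f by (simp add: kernel)
    show "Ju (Jd (\<lambda>x. c * f x)) = (\<lambda>x. c * Ju (Jd f) x)" using f by (simp add: Jd_scale Ju_scale)
    assume k: "k \<in> up.E" "S k = (\<lambda>_. 0)"
    then have "Ju (Jd k) = k" by (simp add: kernel)
    then show "up.ip k (\<lambda>x. f x - Ju (Jd f) x) = 0"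
      using f k(1) adjoint[of "Jd k" "\<lambda>x. f x - Ju (Jd f) x"] by (simp add: Jd_diff ell2_inner_def)
  qed
qed

context
  fixes R S L Lr K KS KL KR z w \<delta>
  assumes R: "positive_operator H R K"
    and S: "kernel_projection H S KS (\<lambda>f. Ju (Jd f))"
    and L: "positive_operator H L KL"
    and Lr: "positive_operator H' Lr KR"
    and L_eq: "\<And>f. f \<in> up.E \<Longrightarrow> L f = (\<lambda>x. R f x + S f x)"
    and Lr_eq: "\<And>g. g \<in> down.E \<Longrightarrow> Lr g = Jd (R (Ju g))"
    and z: "z \<notin> complex_of_real ` {0..}"
    and w: "cmod w = 1" "\<And>t. 0 \<le> t \<Longrightarrow> \<delta> \<le> Re (w * (complex_of_real t - z))" and \<delta>: "0 < \<delta>"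
begin

interpretation R: positive_operator H R K by (rule R)
interpretation S: kernel_projection H S KS "\<lambda>f. Ju (Jd f)" by (rule S)
interpretation L: positive_operator H L KL by (rule L)
interpretation Lr: positive_operator H' Lr KR by (rule Lr)

text \<open>The range of the symmetric S is orthogonal to its kernel, which contains the range of
  \<open>Ju\<close>.\<close>

lemma Jd_S:
  assumes u: "u \<in> up.E"
  shows "Jd (S u) = (\<lambda>_. 0)"
proof -
  let ?g = "Jd (S u)"
  have g: "?g \<in> down.E" using u by simp
  have "S (Ju ?g) = (\<lambda>_. 0)" using S.P_kernel[OF Ju_in_E[OF g]] g by simp
  then have "down.ip ?g ?g = 0"
    using adjoint[OF g, of "S u"] S.T_sym[OF Ju_in_E[OF g] u] u by (simp add: ell2_inner_def)
  then show ?thesis using down.N_eq_0[OF g] by (simp add: down.ip_self)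
qed

text \<open>With \<open>u = (L - z)\<^sup>-\<^sup>1 f\<close>, \<open>q = u - P u\<close> and \<open>X\<close> the reduced resolvent of \<open>S\<close>, the equation
  \<open>(S - z) u = f - R u\<close> gives \<open>q = X (f - R u)\<close>, and compressing to the range of \<open>P\<close> shows that the
  difference of the resolvents at \<open>f\<close> is \<open>q - Ju (Lr - z)\<^sup>-\<^sup>1 Jd R q\<close>.\<close>

lemma resolvent_difference_bound:
  assumes r: "0 \<le> r" "\<And>h. h \<in> up.E \<Longrightarrow> up.N (S.reduced_resolvent z h) \<le> r * up.N h"
    and f: "f \<in> up.E"
  defines "D \<equiv> \<lambda>x. resolvent H L z f x - Ju (resolvent H' Lr z (Jd f)) x"
  shows "D \<in> up.E" "up.N D \<le> (1 + K / \<delta>)\<^sup>2 * r * up.N f"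
proof -
  define u where "u = resolvent H L z f"
  have u: "u \<in> up.E" unfolding u_def by (rule L.resolvent_in_E[OF L.shift_bij[OF z] f])
  have u_eq: "R u x + S u x - z * u x = f x" for x
    using L.shift_resolvent[OF L.shift_bij[OF z] f, of x] L_eq[OF u] by (simp add: u_def)
  define k where "k = (\<lambda>x. f x - R u x)"
  have k: "k \<in> up.E" unfolding k_def using f u by simp
  have k_eq: "k = (\<lambda>x. S u x - z * u x)" using u_eq by (simp add: k_def fun_eq_iff algebra_simps)
  have Jd_k: "Jd k = (\<lambda>x. - z * Jd u x)"
    unfolding k_eq using u by (simp add: Jd_diff Jd_scale Jd_S)
  define q where "q = (\<lambda>x. u x - Ju (Jd u) x)"
  have q: "q \<in> up.E" unfolding q_def using u by simp
  have z0: "z \<noteq> 0" using z by force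
  \<comment> \<open>Here (S - z) u = k, and applying P removes S, so P k = -z P u. Hence X k = u + P
    k / z = u - P u.\<close>
  have "S.reduced_resolvent z k = q"
  proof -
    have "resolvent H S z k = u"
      by (rule S.resolvent_unique[OF S.shift_bij[OF z] u]) (simp add: k_eq)
    then show ?thesis
      unfolding S.reduced_resolvent_def Jd_k Ju_scale[OF Jd_in_E[OF u]] using z0 by (simp add: q_def)
  qed
  then have "up.N q \<le> r * up.N k" using r(2)[OF k] by simp
  moreover have "up.N k \<le> (1 + K / \<delta>) * up.N f"
  proof -
    have "up.N k \<le> up.N f + up.N (R u)" unfolding k_def using f u by (intro up.N_triangle_diff) auto
    also have "up.N (R u) \<le> K * up.N u" by (rule R.T_norm[OF u])
    also have "up.N u \<le> up.N f / \<delta>"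
      using L.resolvent_bound[OF w L.shift_bij[OF z] f] \<delta> by (simp add: u_def field_simps)
    finally show ?thesis using R.K_pos by (simp add: distrib_right)
  qed
  ultimately have Nq: "up.N q \<le> r * ((1 + K / \<delta>) * up.N f)"
    using r(1) by (meson mult_left_mono order_trans)
  define p where "p = Jd u"
  have p: "p \<in> down.E" using u by (simp add: p_def)
  define m where "m = resolvent H' Lr z (Jd (R q))"
  have Rq: "Jd (R q) \<in> down.E" using q by simp
  have m: "m \<in> down.E" unfolding m_def by (rule Lr.resolvent_in_E[OF Lr.shift_bij[OF z] Rq])
  \<comment> \<open>The vector p = \<open>Jd u\<close> satisfies (Lr - z) p = Jd f - Jd R q, since
    \<open>Ju p\<close> = u - q; the summand m corrects this defect.\<close>
  have "resolvent H' Lr z (Jd f) = (\<lambda>x. p x + m x)"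
  proof (rule Lr.resolvent_unique[OF Lr.shift_bij[OF z]])
    show "(\<lambda>x. p x + m x) \<in> down.E" using p m by simp
    fix x
    have "Lr p = (\<lambda>x. Jd (R u) x - Jd (R q) x)"
    proof -
      have "Ju p = (\<lambda>x. u x - q x)" by (simp add: p_def q_def)
      then show ?thesis using u q p by (simp add: Lr_eq R.T_diff Jd_diff)
    qed
    moreover have "Jd (R u) = (\<lambda>x. Jd f x + z * p x)"
    proof -
      have "R u = (\<lambda>x. f x - k x)" by (simp add: k_def)
      then show ?thesis using f k by (simp add: Jd_diff Jd_k p_def)
    qed
    moreover have "Lr m x - z * m x = Jd (R q) x"
      unfolding m_def by (rule Lr.shift_resolvent[OF Lr.shift_bij[OF z] Rq])
    ultimately show "Lr (\<lambda>x. p x + m x) x - z * (p x + m x) = Jd f x"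
      using p m by (simp add: Lr.T_add algebra_simps)
  qed
  then have D: "D = (\<lambda>x. q x - Ju m x)"
    using p m by (simp add: D_def u_def[symmetric] Ju_add q_def p_def algebra_simps)
  show "D \<in> up.E" unfolding D using q m by simp
  have "up.N D \<le> up.N q + down.N m"
    unfolding D using up.N_triangle_diff[of q "Ju m"] q m by (simp add: N_Ju)
  also have "down.N m \<le> K * up.N q / \<delta>"
  proof -
    have "\<delta> * down.N m \<le> down.N (Jd (R q))"
      unfolding m_def by (rule Lr.resolvent_bound[OF w Lr.shift_bij[OF z] Rq])
    also have "\<dots> \<le> up.N (R q)" using q by (intro N_Jd) simp
    also have "\<dots> \<le> K * up.N q" by (rule R.T_norm[OF q])
    finally show ?thesis using \<delta> by (simp add: field_simps)
  qed
  finally have "up.N D \<le> (1 + K / \<delta>) * up.N q" by (simp add: algebra_simps)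
  also have "\<dots> \<le> (1 + K / \<delta>) * (r * ((1 + K / \<delta>) * up.N f))"
    using Nq \<delta> R.K_pos by (intro mult_left_mono) auto
  finally show "up.N D \<le> (1 + K / \<delta>)\<^sup>2 * r * up.N f" by (simp add: power2_eq_square mult_ac)
qed

lemma resolvent_difference_op_norm:
  "op_norm H (\<lambda>f x. resolvent H L z f x - Ju (resolvent H' Lr z (Jd f)) x)
    \<le> ereal ((1 + K / \<delta>)\<^sup>2) * op_norm H (S.reduced_resolvent z)"
proof -
  note fin = S.reduced_resolvent_op_norm_finite[OF z w \<delta>]
  define r where "r = real_of_ereal (op_norm H (S.reduced_resolvent z))"
  have "0 \<le> op_norm H (S.reduced_resolvent z)"
    by (rule up.op_norm_nonneg) (simp add: S.reduced_resolvent_in_E[OF z])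
  then have r: "op_norm H (S.reduced_resolvent z) = ereal r" "0 \<le> r"
    using fin unfolding r_def by (cases "op_norm H (S.reduced_resolvent z)"; simp)+
  have rb: "up.N (S.reduced_resolvent z h) \<le> r * up.N h" if "h \<in> up.E" for h
    using up.op_norm_bound[OF S.reduced_resolvent_scale[OF z] fin that] by (simp add: r_def)
  have "op_norm H (\<lambda>f x. resolvent H L z f x - Ju (resolvent H' Lr z (Jd f)) x)
      \<le> ereal ((1 + K / \<delta>)\<^sup>2 * r)"
  proof (rule up.op_norm_le)
    fix f assume f: "f \<in> up.E" "up.N f \<le> 1"
    have "(1 + K / \<delta>)\<^sup>2 * r * up.N f \<le> (1 + K / \<delta>)\<^sup>2 * r"
      using f(2) r(2) by (intro mult_left_le) auto
    then show "(\<lambda>x. resolvent H L z f x - Ju (resolvent H' Lr z (Jd f)) x) \<in> up.E \<and>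
        up.N (\<lambda>x. resolvent H L z f x - Ju (resolvent H' Lr z (Jd f)) x) \<le> (1 + K / \<delta>)\<^sup>2 * r"
      using resolvent_difference_bound[OF r(2) rb f(1)] by simp
  qed
  then show ?thesis by (simp add: r(1))
qed

end
end

section \<open>Graph Laplacians as positive operators\<close>

text \<open>The degree constant is a parameter because \<open>2 * C\<close> for the original graph
  enters the final constants.\<close>

locale bounded_graph =
  fixes H :: "'v wgraph" and C :: real
  assumes undirected: "undirected_graph H"
    and C_pos: "0 < C" and degree_le: "v \<in> verts H \<Longrightarrow> degree H v \<le> C * mass H v"

sublocale bounded_graph \<subseteq> mass_space H
  using undirected by unfold_locales (auto simp: undirected_graph_def weighted_graph_def)

context bounded_graph
begin

abbreviation "V \<equiv> verts H"
abbreviation "a \<equiv> weight H"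

lemma weight_sym: "x \<in> V \<Longrightarrow> y \<in> V \<Longrightarrow> a x y = a y x"
  using undirected by (auto simp: undirected_graph_def)

lemma weight_nonneg: "x \<in> V \<Longrightarrow> y \<in> V \<Longrightarrow> 0 \<le> a x y"
  using undirected by (auto simp: undirected_graph_def weighted_graph_def)

lemma weight_eq_0: "x \<in> V \<Longrightarrow> y \<in> V \<Longrightarrow> a x y = 0 \<longleftrightarrow> (x, y) \<notin> edges H"
  using undirected unfolding undirected_graph_def weighted_graph_def
  by (metis less_irrefl order_le_less)

lemma edge_verts: "(x, y) \<in> edges H \<Longrightarrow> x \<in> V \<and> y \<in> V"
  using undirected by (auto simp: undirected_graph_def weighted_graph_def)

text \<open>Local finiteness makes all row sums finite sums. The restriction to \<open>V\<close>
  matters, as \<open>weight\<close> is unconstrained elsewhere.\<close>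

lemma finite_neighbours:
  assumes "x \<in> V"
  shows "finite {y \<in> V. a x y \<noteq> 0}"
proof (rule finite_subset)
  show "{y \<in> V. a x y \<noteq> 0} \<subseteq> {y. (x, y) \<in> edges H}" using weight_eq_0[OF assms] by auto
  show "finite {y. (x, y) \<in> edges H}"
    using undirected assms by (auto simp: undirected_graph_def weighted_graph_def)
qed

lemma row_summable:
  assumes "x \<in> V" "\<And>y. a x y = 0 \<Longrightarrow> f y = 0"
  shows "f summable_on V"
  by (rule finite_nonzero_values_imp_summable_on)
    (use assms in \<open>auto intro: finite_subset[OF _ finite_neighbours[OF assms(1)]]\<close>)

lemma row_infsum:
  assumes "x \<in> V" "\<And>y. a x y = 0 \<Longrightarrow> f y = 0"
  shows "infsum f V = (\<Sum>y | y \<in> V \<and> a x y \<noteq> 0. f y)"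
proof -
  have "infsum f V = infsum f {y \<in> V. a x y \<noteq> 0}"
    by (rule infsum_cong_neutral) (use assms(2) in auto)
  then show ?thesis using finite_neighbours[OF assms(1)] by simp
qed

lemma laplacian_eq:
  assumes x: "x \<in> V"
  shows "laplacian H f x * complex_of_real (mass H x) = (\<Sum>\<^sub>\<infinity>y\<in>V. complex_of_real (a x y) * (f x - f y))"
proof -
  have "complex_of_real (degree H x) * f x = (\<Sum>\<^sub>\<infinity>y\<in>V. complex_of_real (a x y) * f x)"
    unfolding degree_def infsum_complex_of_real[symmetric] infsum_cmult_left' ..
  then have "laplacian H f x * complex_of_real (mass H x)
      = (\<Sum>\<^sub>\<infinity>y\<in>V. complex_of_real (a x y) * f x) - (\<Sum>\<^sub>\<infinity>y\<in>V. complex_of_real (a x y) * f y)"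
    using mass_pos[OF x] by (simp add: laplacian_def x)
  also have "\<dots> = (\<Sum>\<^sub>\<infinity>y\<in>V. complex_of_real (a x y) * (f x - f y))"
    by (simp add: row_infsum[OF x] sum_subtractf right_diff_distrib)
  finally show ?thesis .
qed

lemma laplacian_outside: "x \<notin> V \<Longrightarrow> laplacian H f x = 0"
  by (simp add: laplacian_def)

lemma laplacian_cancel:
  assumes "\<And>x. x \<in> V \<Longrightarrow> laplacian H f x * complex_of_real (mass H x) = h x * complex_of_real (mass H x)"
    and "\<And>x. x \<notin> V \<Longrightarrow> h x = 0"
  shows "laplacian H f = h"
proof
  fix x show "laplacian H f x = h x"
    using assms(1)[of x] assms(2)[of x] mass_pos[of x] laplacian_outside[of x f] by (cases "x \<in> V") auto
qed

text \<open>Summing over y first leaves degree times \<phi>, which the degree bound dominates by C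
  \<phi> times the mass. All double sums over edges converge through this estimate.\<close>

lemma pair_summable:
  fixes \<phi> :: "'v \<Rightarrow> real"
  assumes \<phi>: "\<And>x. x \<in> V \<Longrightarrow> 0 \<le> \<phi> x" and s: "(\<lambda>x. \<phi> x * mass H x) summable_on V"
  shows "(\<lambda>(x, y). a x y * \<phi> x) summable_on V \<times> V"
proof (rule summable_on_SigmaI[where g = "\<lambda>x. degree H x * \<phi> x"])
  fix x assume x: "x \<in> V"
  show "((\<lambda>y. case (x, y) of (x, y) \<Rightarrow> a x y * \<phi> x) has_sum degree H x * \<phi> x) V"
    unfolding degree_def prod.case by (intro has_sum_cmult_left has_sum_infsum row_summable[OF x])
  fix y assume y: "y \<in> V"
  show "0 \<le> (case (x, y) of (x, y) \<Rightarrow> a x y * \<phi> x)" using weight_nonneg[OF x y] \<phi>[OF x] by simp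
next
  have "(\<lambda>x. C * (\<phi> x * mass H x)) summable_on V" by (rule summable_on_cmult_right[OF s])
  then show "(\<lambda>x. degree H x * \<phi> x) summable_on V"
  proof (rule summable_on_comparison_test)
    fix x assume x: "x \<in> V"
    show "degree H x * \<phi> x \<le> C * (\<phi> x * mass H x)"
      using mult_right_mono[OF degree_le[OF x] \<phi>[OF x]] by (simp add: mult_ac)
    show "0 \<le> degree H x * \<phi> x"
      using \<phi>[OF x] weight_nonneg[OF x] by (auto simp: degree_def intro!: mult_nonneg_nonneg infsum_nonneg)
  qed
qed

lemma pair_summable':
  fixes \<phi> :: "'v \<Rightarrow> real"
  assumes "\<And>x. x \<in> V \<Longrightarrow> 0 \<le> \<phi> x" "(\<lambda>x. \<phi> x * mass H x) summable_on V"
  shows "(\<lambda>(x, y). a x y * \<phi> y) summable_on V \<times> V"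
  using pair_summable[OF assms]
  by (subst summable_on_swap) (auto elim!: summable_on_cong[THEN iffD1, rotated] simp: weight_sym)

lemma cross_summable:
  assumes f: "f \<in> E" and g: "g \<in> E"
  shows "(\<lambda>(x, y). complex_of_real (a x y) * cnj (f x) * (g x - g y)) summable_on V \<times> V"
proof (rule abs_summable_summable[OF Infinite_Sum.abs_summable_on_comparison_test'])
  have sq: "(\<lambda>(x, y). a x y * (cmod (h x))\<^sup>2) summable_on V \<times> V"
      "(\<lambda>(x, y). a x y * (cmod (h y))\<^sup>2) summable_on V \<times> V" if "h \<in> E" for h
    using that by (intro pair_summable pair_summable' E_summable; simp)+
  show "(\<lambda>p. (case p of (x, y) \<Rightarrow> a x y * (cmod (f x))\<^sup>2) + ((case p of (x, y) \<Rightarrow> a x y * (cmod (g x))\<^sup>2)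
      + (case p of (x, y) \<Rightarrow> a x y * (cmod (g y))\<^sup>2))) summable_on V \<times> V"
    by (intro summable_on_add sq f g)
  fix p assume "p \<in> V \<times> V"
  then obtain x y where p: "p = (x, y)" "x \<in> V" "y \<in> V" by auto
  have "cmod (f x) * cmod (g x - g y) \<le> cmod (f x) * (cmod (g x) + cmod (g y))"
    by (intro mult_left_mono norm_triangle_ineq4) simp
  also have "\<dots> \<le> (cmod (f x))\<^sup>2 + ((cmod (g x))\<^sup>2 + (cmod (g y))\<^sup>2)"
    using sum_squares_bound[of "cmod (f x)" "cmod (g x)"] sum_squares_bound[of "cmod (f x)" "cmod (g y)"]
      zero_le_power2[of "cmod (g x)"] zero_le_power2[of "cmod (g y)"]
    unfolding distrib_left by linarith
  finally have "a x y * (cmod (f x) * cmod (g x - g y))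
      \<le> a x y * ((cmod (f x))\<^sup>2 + ((cmod (g x))\<^sup>2 + (cmod (g y))\<^sup>2))"
    using weight_nonneg[OF p(2,3)] by (rule mult_left_mono)
  then show "cmod (case p of (x, y) \<Rightarrow> complex_of_real (a x y) * cnj (f x) * (g x - g y))
     \<le> (case p of (x, y) \<Rightarrow> a x y * (cmod (f x))\<^sup>2) + ((case p of (x, y) \<Rightarrow> a x y * (cmod (g x))\<^sup>2)
      + (case p of (x, y) \<Rightarrow> a x y * (cmod (g y))\<^sup>2))"
    using weight_nonneg[OF p(2,3)] by (simp add: p(1) norm_mult distrib_left mult.assoc)
qed

text \<open>The sum runs over ordered pairs, so an edge between distinct vertices counts twice; this
  explains the factor 1/2 in \<open>ip_laplacian\<close>.\<close>

definition energy :: "('v \<Rightarrow> complex) \<Rightarrow> ('v \<Rightarrow> complex) \<Rightarrow> complex" where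
  "energy f g = (\<Sum>\<^sub>\<infinity>(x, y)\<in>V \<times> V. complex_of_real (a x y) * cnj (f x - f y) * (g x - g y))"

text \<open>Green's formula: exchanging x and y in the double sum and averaging turns cnj (f x) (g x
  - g y) into half the product of differences. Summability over pairs justifies the
  exchange.\<close>

lemma energy:
  assumes f: "f \<in> E" and g: "g \<in> E"
  shows ip_laplacian: "ip f (laplacian H g) = energy f g / 2"
    and energy_summable: "(\<lambda>(x, y). complex_of_real (a x y) * cnj (f x - f y) * (g x - g y)) summable_on V \<times> V"
proof -
  let ?F = "\<lambda>x y. complex_of_real (a x y) * cnj (f x) * (g x - g y)"
  note s = cross_summable[OF f g]
  have s': "(\<lambda>(x, y). ?F y x) summable_on V \<times> V"
    using s by (subst summable_on_swap) (simp add: case_prod_unfold)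
  have eq: "(\<lambda>(x, y). ?F x y) p + (\<lambda>(x, y). ?F y x) p
      = (\<lambda>(x, y). complex_of_real (a x y) * cnj (f x - f y) * (g x - g y)) p" if "p \<in> V \<times> V" for p
    using that by (auto simp: weight_sym algebra_simps)
  show "(\<lambda>(x, y). complex_of_real (a x y) * cnj (f x - f y) * (g x - g y)) summable_on V \<times> V"
    using summable_on_add[OF s s'] by (rule summable_on_cong[THEN iffD1, rotated]) (rule eq)
  have "ip f (laplacian H g) = (\<Sum>\<^sub>\<infinity>x\<in>V. \<Sum>\<^sub>\<infinity>y\<in>V. ?F x y)"
    unfolding ell2_inner_def
  proof (rule infsum_cong)
    fix x assume x: "x \<in> V"
    have "cnj (f x) * laplacian H g x * complex_of_real (mass H x)
        = cnj (f x) * (\<Sum>\<^sub>\<infinity>y\<in>V. complex_of_real (a x y) * (g x - g y))"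
      using laplacian_eq[OF x, of g] by (simp add: mult.assoc)
    also have "\<dots> = (\<Sum>\<^sub>\<infinity>y\<in>V. ?F x y)"
      by (subst infsum_cmult_right'[symmetric]) (simp add: mult_ac)
    finally show "cnj (f x) * laplacian H g x * complex_of_real (mass H x) = (\<Sum>\<^sub>\<infinity>y\<in>V. ?F x y)" .
  qed
  then have i: "ip f (laplacian H g) = infsum (\<lambda>(x, y). ?F x y) (V \<times> V)"
    using infsum_Sigma'_banach[OF s] by simp
  also have "\<dots> = (\<Sum>\<^sub>\<infinity>x\<in>V. \<Sum>\<^sub>\<infinity>y\<in>V. ?F y x)"
    using infsum_Sigma'_banach[OF s] infsum_swap_banach[OF s] by simp
  also have "\<dots> = infsum (\<lambda>(x, y). ?F y x) (V \<times> V)" by (rule infsum_Sigma'_banach[OF s'])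
  finally have "2 * ip f (laplacian H g) = infsum (\<lambda>(x, y). ?F x y) (V \<times> V) + infsum (\<lambda>(x, y). ?F y x) (V \<times> V)"
    using i by simp
  also have "\<dots> = energy f g"
    unfolding energy_def infsum_add[OF s s', symmetric] by (rule infsum_cong) (rule eq)
  finally show "ip f (laplacian H g) = energy f g / 2" by (simp add: eq_divide_eq mult.commute)
qed

lemma energy_self:
  assumes g: "g \<in> E"
  shows "(\<lambda>(x, y). a x y * (cmod (g x - g y))\<^sup>2) summable_on V \<times> V"
    and "Re (ip g (laplacian H g)) = (\<Sum>\<^sub>\<infinity>(x, y)\<in>V \<times> V. a x y * (cmod (g x - g y))\<^sup>2) / 2"
proof -
  have eq: "(\<lambda>(x, y). complex_of_real (a x y) * cnj (g x - g y) * (g x - g y))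
      = (\<lambda>p. complex_of_real (case p of (x, y) \<Rightarrow> a x y * (cmod (g x - g y))\<^sup>2))"
    by (auto simp only: fun_eq_iff of_real_mult complex_norm_square split: prod.splits)
       (simp only: mult_ac)
  show "(\<lambda>(x, y). a x y * (cmod (g x - g y))\<^sup>2) summable_on V \<times> V"
    using summable_on_Re[OF energy_summable[OF g g, unfolded eq]] by simp
  show "Re (ip g (laplacian H g)) = (\<Sum>\<^sub>\<infinity>(x, y)\<in>V \<times> V. a x y * (cmod (g x - g y))\<^sup>2) / 2"
    unfolding ip_laplacian[OF g g] energy_def eq infsum_complex_of_real by simp
qed

text \<open>Weighted Cauchy-Schwarz in each row bounds the squared row by the degree times the local
  energy. The degree costs C times the mass, and the local energies add up to twice the quadratic
  form; hence 2 C.\<close>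

lemma laplacian_in_E_bound:
  assumes g: "g \<in> E"
  shows "laplacian H g \<in> E" "(N (laplacian H g))\<^sup>2 \<le> 2 * C * Re (ip g (laplacian H g))"
proof -
  let ?e = "\<lambda>x. \<Sum>\<^sub>\<infinity>y\<in>V. a x y * (cmod (g x - g y))\<^sup>2"
  have pt: "(cmod (laplacian H g x))\<^sup>2 * mass H x \<le> C * ?e x" if x: "x \<in> V" for x
  proof -
    let ?F = "{y \<in> V. a x y \<noteq> 0}"
    note m = mass_pos[OF x]
    have e: "?e x = (\<Sum>y\<in>?F. a x y * (cmod (g x - g y))\<^sup>2)" by (rule row_infsum[OF x]) simp
    have d: "degree H x = (\<Sum>y\<in>?F. a x y)" unfolding degree_def by (rule row_infsum[OF x]) simp
    have e0: "0 \<le> ?e x" unfolding e using weight_nonneg[OF x] by (auto intro!: sum_nonneg)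
    have "cmod (laplacian H g x) * mass H x = cmod (laplacian H g x * complex_of_real (mass H x))"
      using m by (simp add: norm_mult)
    also have "\<dots> = cmod (\<Sum>y\<in>?F. complex_of_real (a x y) * (g x - g y))"
      unfolding laplacian_eq[OF x] by (subst row_infsum[OF x]) simp_all
    also have "\<dots> \<le> (\<Sum>y\<in>?F. sqrt (a x y) * (sqrt (a x y) * cmod (g x - g y)))"
      using weight_nonneg[OF x]
      by (intro sum_norm_le) (auto simp: norm_mult mult.assoc[symmetric])
    finally have "(cmod (laplacian H g x) * mass H x)\<^sup>2
        \<le> (\<Sum>y\<in>?F. sqrt (a x y) * (sqrt (a x y) * cmod (g x - g y)))\<^sup>2"
      using m by (intro power_mono) auto
    also have "\<dots> \<le> (\<Sum>y\<in>?F. (sqrt (a x y))\<^sup>2) * (\<Sum>y\<in>?F. (sqrt (a x y) * cmod (g x - g y))\<^sup>2)"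
      by (rule Cauchy_Schwarz_ineq_sum)
    also have "\<dots> = degree H x * ?e x"
      unfolding d e using weight_nonneg[OF x] by (simp add: power_mult_distrib)
    also have "\<dots> \<le> C * mass H x * ?e x" by (rule mult_right_mono[OF degree_le[OF x] e0])
    finally show ?thesis using m by (simp add: power2_eq_square)
  qed
  note s = energy_self(1)[OF g]
  have s': "(\<lambda>x. C * ?e x) summable_on V" by (rule summable_on_cmult_right[OF summable_on_Sigma_banach[OF s]])
  have sl: "(\<lambda>x. (cmod (laplacian H g x))\<^sup>2 * mass H x) summable_on V"
    by (rule summable_on_comparison_test[OF s' pt]) (auto intro!: mult_nonneg_nonneg less_imp_le[OF mass_pos])
  then show "laplacian H g \<in> E" by (simp add: ell2_def laplacian_outside)
  have "(N (laplacian H g))\<^sup>2 \<le> (\<Sum>\<^sub>\<infinity>x\<in>V. C * ?e x)"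
    unfolding N_sq by (rule infsum_mono[OF sl s' pt])
  also have "\<dots> = C * (\<Sum>\<^sub>\<infinity>(x, y)\<in>V \<times> V. a x y * (cmod (g x - g y))\<^sup>2)"
    unfolding infsum_cmult_right' infsum_Sigma'_banach[OF s] ..
  also have "(\<Sum>\<^sub>\<infinity>(x, y)\<in>V \<times> V. a x y * (cmod (g x - g y))\<^sup>2) = 2 * Re (ip g (laplacian H g))"
    using energy_self(2)[OF g] by simp
  finally show "(N (laplacian H g))\<^sup>2 \<le> 2 * C * Re (ip g (laplacian H g))"
    by (simp add: mult_ac)
qed

lemma laplacian_positive: "positive_operator H (laplacian H) (2 * C)"
proof
  fix f g :: "'v \<Rightarrow> complex" and c assume f: "f \<in> E"
  show "laplacian H f \<in> E" "(N (laplacian H f))\<^sup>2 \<le> 2 * C * Re (ip f (laplacian H f))"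
    using laplacian_in_E_bound[OF f] by auto
  show "laplacian H (\<lambda>x. c * f x) = (\<lambda>x. c * laplacian H f x)"
  proof (rule laplacian_cancel)
    fix x assume x: "x \<in> V"
    show "laplacian H (\<lambda>x. c * f x) x * complex_of_real (mass H x)
        = c * laplacian H f x * complex_of_real (mass H x)"
      unfolding laplacian_eq[OF x] mult.assoc
      by (subst infsum_cmult_right'[symmetric]) (simp add: algebra_simps)
  qed (simp add: laplacian_outside)
  assume g: "g \<in> E"
  show "laplacian H (\<lambda>x. f x + g x) = (\<lambda>x. laplacian H f x + laplacian H g x)"
  proof (rule laplacian_cancel)
    fix x assume x: "x \<in> V"
    show "laplacian H (\<lambda>x. f x + g x) x * complex_of_real (mass H x)
        = (laplacian H f x + laplacian H g x) * complex_of_real (mass H x)"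
      unfolding laplacian_eq[OF x] distrib_right
      by (simp add: row_infsum[OF x] sum.distrib[symmetric] algebra_simps)
  qed (simp add: laplacian_outside)
  have "energy f g = cnj (energy g f)"
    unfolding energy_def infsum_cnj[symmetric] by (rule infsum_cong) (auto simp: mult_ac)
  moreover have "ip (laplacian H f) g = cnj (energy g f / 2)"
    unfolding ip_laplacian[OF g f, symmetric] ip_cnj ..
  ultimately show "ip f (laplacian H g) = ip (laplacian H f) g"
    unfolding ip_laplacian[OF f g] by simp
qed (use C_pos in simp)

text \<open>A vanishing sum of nonnegative edge terms vanishes termwise. Only the edge set appears
  on the right, which is why the kernel of the cluster Laplacian is the same for all
  \<beta>.\<close>

lemma laplacian_kernel:
  assumes f: "f \<in> E"
  shows "laplacian H f = (\<lambda>_. 0) \<longleftrightarrow> (\<forall>(x, y)\<in>edges H. f x = f y)"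
proof
  assume "laplacian H f = (\<lambda>_. 0)"
  then have "(\<Sum>\<^sub>\<infinity>(x, y)\<in>V \<times> V. a x y * (cmod (f x - f y))\<^sup>2) \<le> 0"
    using energy_self(2)[OF f] by (simp add: ell2_inner_def)
  then have z: "(\<lambda>(x, y). a x y * (cmod (f x - f y))\<^sup>2) p = 0" if that: "p \<in> V \<times> V" for p
    by (rule nonneg_infsum_le_0D[OF _ energy_self(1)[OF f] _ that])
      (use weight_nonneg in auto)
  show "\<forall>(x, y)\<in>edges H. f x = f y"
    using z edge_verts weight_eq_0 by fastforce
next
  assume e: "\<forall>(x, y)\<in>edges H. f x = f y"
  show "laplacian H f = (\<lambda>_. 0)"
  proof (rule laplacian_cancel)
    fix x assume x: "x \<in> V"
    show "laplacian H f x * complex_of_real (mass H x) = 0 * complex_of_real (mass H x)"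
      unfolding laplacian_eq[OF x] mult_zero_left
      by (rule infsum_0) (use e x weight_eq_0[OF x] in auto)
  qed simp
qed

end

section \<open>Splitting a Laplacian along a partition of the edges\<close>

lemma bounded_graphI:
  assumes "undirected_graph H" "bounded_degree H"
  obtains C where "bounded_graph H C"
  using assms unfolding bounded_degree_def bounded_graph_def by blast

lemma (in bounded_graph) subgraph_bounded:
  assumes F: "F \<subseteq> edges H" "sym F"
  shows "bounded_graph (subgraph H F) C"
proof
  have "weight H v w > 0" if "(v, w) \<in> F" for v w
    using that F(1) undirected unfolding undirected_graph_def weighted_graph_def by blast
  moreover have "finite {w. (v, w) \<in> F} \<and> finite {w. (w, v) \<in> F}" if "v \<in> V" for v
  proof -
    have "finite {w. (v, w) \<in> edges H}" "finite {w. (w, v) \<in> edges H}"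
      using undirected that by (auto simp: undirected_graph_def weighted_graph_def)
    then show ?thesis
      using F(1) finite_subset[of "{w. (v, w) \<in> F}" "{w. (v, w) \<in> edges H}"]
        finite_subset[of "{w. (w, v) \<in> F}" "{w. (w, v) \<in> edges H}"] by auto
  qed
  ultimately show "undirected_graph (subgraph H F)"
    using undirected F unfolding undirected_graph_def weighted_graph_def subgraph_def
    by (auto simp: sym_def less_imp_le)
  show "0 < C" by (rule C_pos)
  fix v assume "v \<in> verts (subgraph H F)"
  then have v: "v \<in> V" by (simp add: subgraph_def)
  have "degree (subgraph H F) v \<le> degree H v"
    unfolding degree_def subgraph_def
    by (simp, intro infsum_mono row_summable[OF v]) (use weight_nonneg[OF v] in auto)
  also have "\<dots> \<le> C * mass H v" by (rule degree_le[OF v])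
  finally show "degree (subgraph H F) v \<le> C * mass (subgraph H F) v" by (simp add: subgraph_def)
qed

lemma (in bounded_graph) laplacian_split:
  assumes F: "F \<subseteq> edges H" "sym F"
  shows "laplacian H f x = laplacian (subgraph H (edges H - F)) f x + laplacian (subgraph H F) f x"
proof (cases "x \<in> V")
  case True
  let ?A = "subgraph H (edges H - F)" and ?B = "subgraph H F"
  have "sym (edges H - F)" using undirected F(2) by (auto simp: undirected_graph_def sym_def)
  then interpret A: bounded_graph ?A C by (intro subgraph_bounded) auto
  interpret B: bounded_graph ?B C by (intro subgraph_bounded F)
  have "(\<Sum>\<^sub>\<infinity>y\<in>V. complex_of_real (a x y) * (f x - f y))
      = (\<Sum>\<^sub>\<infinity>y\<in>V. complex_of_real (weight ?A x y) * (f x - f y) + complex_of_real (weight ?B x y) * (f x - f y))"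
    by (rule infsum_cong) (use True weight_eq_0[OF True] F(1) in \<open>auto simp: subgraph_def\<close>)
  also have "\<dots> = (\<Sum>\<^sub>\<infinity>y\<in>V. complex_of_real (weight ?A x y) * (f x - f y))
      + (\<Sum>\<^sub>\<infinity>y\<in>V. complex_of_real (weight ?B x y) * (f x - f y))"
    by (intro infsum_add row_summable[OF True]) (auto simp: subgraph_def)
  finally have "laplacian H f x * complex_of_real (mass H x)
      = (laplacian ?A f x + laplacian ?B f x) * complex_of_real (mass H x)"
    using laplacian_eq[OF True, of f] A.laplacian_eq[of x f] B.laplacian_eq[of x f] True
    by (simp add: subgraph_def distrib_right)
  then show ?thesis using mass_pos[OF True] by simp
qed (simp add: laplacian_def subgraph_def)

section \<open>Clusters and the reduced graph\<close>

lemma infsum_disjoint_Union: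
  fixes f :: "'a \<Rightarrow> 'b::banach"
  assumes disj: "disjoint_family_on B I" and f: "f summable_on (\<Union>i\<in>I. B i)"
  shows "infsum f (\<Union>i\<in>I. B i) = (\<Sum>\<^sub>\<infinity>i\<in>I. infsum f (B i))"
proof -
  have inj: "inj_on snd (Sigma I B)"
    using disj by (force simp: disjoint_family_on_def inj_on_def)
  have U: "(\<Union>i\<in>I. B i) = snd ` Sigma I B" by force
  have "(f \<circ> snd) summable_on Sigma I B"
    using f unfolding U summable_on_reindex[OF inj] .
  then have "(\<lambda>(i, x). f x) summable_on Sigma I B" by (simp add: comp_def case_prod_unfold)
  then have "(\<Sum>\<^sub>\<infinity>i\<in>I. infsum f (B i)) = (\<Sum>\<^sub>\<infinity>(i, x)\<in>Sigma I B. f x)"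
    by (rule infsum_Sigma'_banach)
  also have "\<dots> = infsum f (\<Union>i\<in>I. B i)"
    unfolding U infsum_reindex[OF inj] by (simp add: comp_def case_prod_unfold)
  finally show ?thesis ..
qed

lemma summable_on_indicator_times:
  fixes f :: "'a \<Rightarrow> real"
  assumes "f summable_on D" "D \<subseteq> A"
  shows "(\<lambda>x. indicator D x * f x) summable_on A"
proof -
  have "(\<lambda>x. indicator D x * f x) summable_on A \<longleftrightarrow> f summable_on D"
    by (rule summable_on_cong_neutral) (use assms(2) in \<open>auto simp: indicator_def\<close>)
  then show ?thesis using assms(1) by simp
qed

text \<open>The single clusters are forgotten: what the reduced graph requires of them is their
  union and the finite mass of its components.\<close>

locale clustered_graph = bounded_graph G C for G :: "'v wgraph" and C +
  fixes F :: "('v \<times> 'v) set"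
  assumes F_edges: "F \<subseteq> edges G" and F_sym: "sym F"
    and component_mass: "x \<in> V \<Longrightarrow> mass G summable_on F\<^sup>* `` {x}"
begin

abbreviation "comps \<equiv> components G F"
abbreviation "cluster x \<equiv> F\<^sup>* `` {x}"
abbreviation "Gred \<equiv> reduced_graph G F"

lemma comp_subset: "x \<in> V \<Longrightarrow> cluster x \<subseteq> V"
proof
  fix y assume x: "x \<in> V" and "y \<in> cluster x"
  then have "(x, y) \<in> F\<^sup>*" by simp
  then show "y \<in> V"
    by (induction rule: rtrancl_induct) (use x F_edges edge_verts in auto)
qed

lemma comp_eq: "(x, y) \<in> F\<^sup>* \<Longrightarrow> cluster x = cluster y"
  using sym_rtrancl[OF F_sym] by (auto dest: symD intro: rtrancl_trans)

lemma comp_in_comps: "x \<in> V \<Longrightarrow> cluster x \<in> comps"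
  by (simp add: components_def quotientI)

lemma compsE:
  assumes "D \<in> comps"
  obtains x where "x \<in> V" "D = cluster x"
  using assms unfolding components_def by (rule quotientE)

lemma comps_comp: "D \<in> comps \<Longrightarrow> x \<in> D \<Longrightarrow> D = cluster x"
  by (elim compsE) (auto dest: comp_eq)

lemma comps_subset: "D \<in> comps \<Longrightarrow> D \<subseteq> V"
  by (elim compsE) (simp add: comp_subset)

lemma Union_comps: "(\<Union>D\<in>comps. D) = V"
  using comps_subset comp_in_comps by blast

lemma disjoint_comps: "disjoint_family_on (\<lambda>D. D) comps"
  unfolding disjoint_family_on_def using comps_comp by blast

lemma mass_summable: "D \<in> comps \<Longrightarrow> mass G summable_on D"
  by (elim compsE) (simp add: component_mass)

lemma comps_nonempty: "D \<in> comps \<Longrightarrow> \<exists>x. x \<in> D"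
  by (elim compsE) auto

lemma reduced_simps [simp]: "verts Gred = comps" "mass Gred D = (\<Sum>\<^sub>\<infinity>v\<in>D. mass G v)"
  "weight Gred = reduced_weight G"
  by (simp_all add: reduced_graph_def)

lemma mass_reduced_pos:
  assumes D: "D \<in> comps"
  shows "0 < (\<Sum>\<^sub>\<infinity>v\<in>D. mass G v)"
proof -
  obtain x where x: "x \<in> D" using comps_nonempty[OF D] ..
  \<comment> \<open>One vertex already gives positive mass; summability is essential in the next
    step, because a divergent sum would default to 0.\<close>
  have "0 < (\<Sum>v\<in>{x}. mass G v)" using mass_pos comps_subset[OF D] x by auto
  also have "\<dots> \<le> (\<Sum>\<^sub>\<infinity>v\<in>D. mass G v)"
    by (rule finite_sum_le_infsum[OF mass_summable[OF D]])
      (use x comps_subset[OF D] mass_pos less_imp_le in blast)+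
  finally show ?thesis .
qed

sublocale red: mass_space Gred
  by unfold_locales (simp add: mass_reduced_pos)

lemma infsum_comps:
  fixes f :: "'v \<Rightarrow> 'b::banach"
  assumes "f summable_on V"
  shows "infsum f V = (\<Sum>\<^sub>\<infinity>D\<in>comps. infsum f D)"
  using infsum_disjoint_Union[OF disjoint_comps, of f] assms unfolding Union_comps by simp

section \<open>Averaging over components and its adjoint\<close>

lemma J_up_apply:
  assumes x: "x \<in> V"
  shows "J_up G F g x = g (cluster x)"
proof -
  have "J_up G F g x = (\<Sum>\<^sub>\<infinity>D\<in>{cluster x}. g D * indicator D x)"
    unfolding J_up_def
  proof (rule infsum_cong_neutral)
    fix D assume "D \<in> comps - {cluster x}"
    then have "x \<notin> D" using comps_comp[of D x] by auto
    then show "g D * indicator D x = 0" by simp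
  qed (use comp_in_comps[OF x] in auto)
  then show ?thesis by simp
qed

lemma J_up_outside: "x \<notin> V \<Longrightarrow> J_up G F g x = 0"
  unfolding J_up_def by (rule infsum_0) (use comps_subset in \<open>auto simp: indicator_def\<close>)

lemma J_up_comps: "D \<in> comps \<Longrightarrow> x \<in> D \<Longrightarrow> J_up G F g x = g D"
  using J_up_apply[of x g] comps_comp[of D x] comps_subset[of D] by auto

lemma J_up_in_E:
  assumes g: "g \<in> red.E"
  shows "J_up G F g \<in> E"
proof -
  have "(\<lambda>v. (cmod (J_up G F g v))\<^sup>2 * mass G v) summable_on (\<Union>D\<in>comps. D)"
  proof (rule summable_on_UnionI[where g = "\<lambda>D. (cmod (g D))\<^sup>2 * mass Gred D"])
    fix D assume D: "D \<in> comps"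
    have "((\<lambda>v. (cmod (g D))\<^sup>2 * mass G v) has_sum (cmod (g D))\<^sup>2 * mass Gred D) D"
      unfolding reduced_simps by (intro has_sum_cmult_right has_sum_infsum mass_summable D)
    then show "((\<lambda>v. (cmod (J_up G F g v))\<^sup>2 * mass G v) has_sum (cmod (g D))\<^sup>2 * mass Gred D) D"
      by (rule has_sum_cong[THEN iffD1, rotated]) (simp add: J_up_comps[OF D])
  next
    show "(\<lambda>D. (cmod (g D))\<^sup>2 * mass Gred D) summable_on comps"
      using red.E_summable[OF g] by simp
  qed (auto intro!: disjoint_comps mult_nonneg_nonneg less_imp_le[OF mass_pos] dest: comps_subset)
  then show ?thesis unfolding Union_comps by (simp add: ell2_def J_up_outside)
qed

lemma indicator_in_E:
  assumes D: "D \<in> comps"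
  shows "indicator D \<in> E" and "(N (indicator D))\<^sup>2 = mass Gred D"
proof -
  have eq: "(\<lambda>v. (cmod (indicator D v))\<^sup>2 * mass G v) = (\<lambda>v. indicator D v * mass G v)"
    by (auto simp: indicator_def)
  have "(\<lambda>v. indicator D v * mass G v) summable_on V"
    by (rule summable_on_indicator_times[OF mass_summable[OF D] comps_subset[OF D]])
  then show "indicator D \<in> E"
    unfolding ell2_def mem_Collect_eq eq using comps_subset[OF D] by (auto simp: indicator_def)
  show "(N (indicator D))\<^sup>2 = mass Gred D"
    unfolding N_sq eq reduced_simps
    by (rule infsum_cong_neutral) (use comps_subset[OF D] in \<open>auto simp: indicator_def\<close>)
qed

lemma ip_indicator:
  assumes D: "D \<in> comps"
  shows "ip (indicator D) f = (\<Sum>\<^sub>\<infinity>x\<in>D. f x * complex_of_real (mass G x))"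
  unfolding ell2_inner_def
  by (rule infsum_cong_neutral) (use comps_subset[OF D] in \<open>auto simp: indicator_def\<close>)

lemma J_down_mass:
  assumes D: "D \<in> comps"
  shows "J_down G F f D * complex_of_real (mass Gred D) = (\<Sum>\<^sub>\<infinity>x\<in>D. f x * complex_of_real (mass G x))"
  using mass_reduced_pos[OF D] D by (simp add: J_down_def ip_indicator)

text \<open>Jensen's inequality for the mean over D, obtained from Cauchy-Schwarz against the
  indicator, whose squared norm is the mass of D.\<close>

lemma J_down_bound:
  assumes f: "f \<in> E" and D: "D \<in> comps"
  shows "(cmod (J_down G F f D))\<^sup>2 * mass Gred D \<le> (\<Sum>\<^sub>\<infinity>x\<in>D. (cmod (f x))\<^sup>2 * mass G x)"
proof -
  note m = mass_reduced_pos[OF D]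
  let ?f = "\<lambda>x. indicator D x * f x"
  have eq: "(\<lambda>x. (cmod (?f x))\<^sup>2 * mass G x) = (\<lambda>x. indicator D x * ((cmod (f x))\<^sup>2 * mass G x))"
    by (auto simp: indicator_def)
  have sD: "(\<lambda>x. (cmod (f x))\<^sup>2 * mass G x) summable_on D"
    by (rule summable_on_subset_banach[OF E_summable[OF f] comps_subset[OF D]])
  have "(\<lambda>x. indicator D x * ((cmod (f x))\<^sup>2 * mass G x)) summable_on V"
    by (rule summable_on_indicator_times[OF sD comps_subset[OF D]])
  then have fE: "?f \<in> E" using E_outside[OF f] unfolding ell2_def mem_Collect_eq eq by simp
  have Nf: "(N ?f)\<^sup>2 = (\<Sum>\<^sub>\<infinity>x\<in>D. (cmod (f x))\<^sup>2 * mass G x)"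
    unfolding N_sq eq
    by (rule infsum_cong_neutral) (use comps_subset[OF D] in \<open>auto simp: indicator_def\<close>)
  have "cmod (J_down G F f D) * mass Gred D = cmod (J_down G F f D * complex_of_real (mass Gred D))"
    using m by (simp add: norm_mult)
  also have "\<dots> = cmod (ip (indicator D) ?f)"
    unfolding J_down_mass[OF D] ip_indicator[OF D]
    by (intro arg_cong[where f = cmod] infsum_cong) simp
  also have "\<dots> \<le> N (indicator D) * N ?f"
    by (rule Cauchy_Schwarz[OF indicator_in_E(1)[OF D] fE])
  finally have "(cmod (J_down G F f D) * mass Gred D)\<^sup>2 \<le> (N (indicator D) * N ?f)\<^sup>2"
    using m by (intro power_mono) auto
  also have "\<dots> = mass Gred D * (\<Sum>\<^sub>\<infinity>x\<in>D. (cmod (f x))\<^sup>2 * mass G x)"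
    unfolding power_mult_distrib indicator_in_E(2)[OF D] Nf ..
  finally show ?thesis using m by (simp add: power2_eq_square)
qed

lemma J_down_in_E:
  assumes f: "f \<in> E"
  shows "J_down G F f \<in> red.E"
proof -
  have sD: "(\<lambda>x. (cmod (f x))\<^sup>2 * mass G x) summable_on D" if "D \<in> comps" for D
    by (rule summable_on_subset_banach[OF E_summable[OF f] comps_subset[OF that]])
  have "(\<lambda>D. \<Sum>\<^sub>\<infinity>x\<in>D. (cmod (f x))\<^sup>2 * mass G x) summable_on comps"
    by (rule summable_on_UnionD[OF _ sD disjoint_comps])
      (use E_summable[OF f] in \<open>simp_all add: Union_comps[simplified]\<close>)
  then have "(\<lambda>D. (cmod (J_down G F f D))\<^sup>2 * mass Gred D) summable_on comps"
    by (rule summable_on_comparison_test)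
      (use J_down_bound[OF f] less_imp_le[OF mass_reduced_pos] in auto)
  then show ?thesis by (simp add: ell2_def) (simp add: J_down_def)
qed

lemma J_down_J_up:
  assumes g: "g \<in> red.E"
  shows "J_down G F (J_up G F g) = g"
proof
  fix D show "J_down G F (J_up G F g) D = g D"
  proof (cases "D \<in> comps")
    case True
    have "(\<Sum>\<^sub>\<infinity>x\<in>D. J_up G F g x * complex_of_real (mass G x)) = g D * complex_of_real (mass Gred D)"
      unfolding reduced_simps infsum_complex_of_real[symmetric] infsum_cmult_right'[symmetric]
      by (rule infsum_cong) (simp add: J_up_comps True)
    then show ?thesis
      using J_down_mass[OF True, of "J_up G F g"] mass_reduced_pos[OF True] by simp
  next
    case False
    then show ?thesis using red.E_outside[OF g, of D] by (simp add: J_down_def)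
  qed
qed

lemma J_adjoint:
  assumes g: "g \<in> red.E" and f: "f \<in> E"
  shows "red.ip g (J_down G F f) = ip (J_up G F g) f"
proof -
  have "ip (J_up G F g) f
      = (\<Sum>\<^sub>\<infinity>D\<in>comps. \<Sum>\<^sub>\<infinity>x\<in>D. cnj (J_up G F g x) * f x * complex_of_real (mass G x))"
    unfolding ell2_inner_def by (rule infsum_comps[OF ip_summable[OF J_up_in_E[OF g] f]])
  also have "\<dots> = (\<Sum>\<^sub>\<infinity>D\<in>comps. cnj (g D) * J_down G F f D * complex_of_real (mass Gred D))"
  proof (rule infsum_cong)
    fix D assume D: "D \<in> comps"
    show "(\<Sum>\<^sub>\<infinity>x\<in>D. cnj (J_up G F g x) * f x * complex_of_real (mass G x))
        = cnj (g D) * J_down G F f D * complex_of_real (mass Gred D)"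
      unfolding mult.assoc J_down_mass[OF D] infsum_cmult_right'[symmetric]
      by (rule infsum_cong) (simp add: J_up_comps D)
  qed
  also have "\<dots> = red.ip g (J_down G F f)" unfolding ell2_inner_def by simp
  finally show ?thesis ..
qed

sublocale ell2_isometry G Gred "J_up G F" "J_down G F"
proof
  fix g h c assume g: "g \<in> red.E"
  show "J_up G F g \<in> E" by (rule J_up_in_E[OF g])
  show "J_up G F (\<lambda>x. c * g x) = (\<lambda>x. c * J_up G F g x)"
  proof
    fix x show "J_up G F (\<lambda>x. c * g x) x = c * J_up G F g x"
      by (cases "x \<in> V") (simp_all add: J_up_apply J_up_outside)
  qed
  show "J_down G F (J_up G F g) = g" by (rule J_down_J_up[OF g])
  show "red.ip g (J_down G F f) = ip (J_up G F g) f" if "f \<in> E" for f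
    by (rule J_adjoint[OF g that])
  show "J_up G F (\<lambda>x. g x + h x) = (\<lambda>x. J_up G F g x + J_up G F h x)"
  proof
    fix x show "J_up G F (\<lambda>x. g x + h x) x = J_up G F g x + J_up G F h x"
      by (cases "x \<in> V") (simp_all add: J_up_apply J_up_outside)
  qed
next
  fix f k c assume f: "f \<in> E"
  show "J_down G F f \<in> red.E" by (rule J_down_in_E[OF f])
  show "J_down G F (\<lambda>x. c * f x) = (\<lambda>D. c * J_down G F f D)"
    by (simp add: J_down_def fun_eq_iff ip_scale_right)
  show "J_down G F (\<lambda>x. f x + k x) = (\<lambda>D. J_down G F f D + J_down G F k D)" if "k \<in> E"
    using f that indicator_in_E(1) by (simp add: J_down_def fun_eq_iff ip_add_right add_divide_distrib)
qed

text \<open>The composite replaces a function by its mean on each component; a function equals its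
  means exactly if it is constant along the edges that generate the components.\<close>

lemma J_up_J_down_eq_iff:
  assumes f: "f \<in> E"
  shows "J_up G F (J_down G F f) = f \<longleftrightarrow> (\<forall>(x, y)\<in>F. f x = f y)"
proof
  assume eq: "J_up G F (J_down G F f) = f"
  have "f x = f y" if "(x, y) \<in> F" for x y
  proof -
    have "x \<in> V" "y \<in> V" using that F_edges edge_verts by auto
    moreover have "cluster x = cluster y" using that by (intro comp_eq) auto
    ultimately show ?thesis using J_up_apply[of _ "J_down G F f"] eq by metis
  qed
  then show "\<forall>(x, y)\<in>F. f x = f y" by auto
next
  assume c: "\<forall>(x, y)\<in>F. f x = f y"
  have const: "f y = f x" if "(x, y) \<in> F\<^sup>*" for x y
    using that by (induction rule: rtrancl_induct) (use c in auto)
  show "J_up G F (J_down G F f) = f"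
  proof
    fix x show "J_up G F (J_down G F f) x = f x"
    proof (cases "x \<in> V")
      case True
      note D = comp_in_comps[OF True]
      have "(\<Sum>\<^sub>\<infinity>y\<in>cluster x. f y * complex_of_real (mass G y)) = f x * complex_of_real (mass Gred (cluster x))"
        unfolding reduced_simps infsum_complex_of_real[symmetric] infsum_cmult_right'[symmetric]
        by (rule infsum_cong) (auto dest: const)
      then show ?thesis
        using J_down_mass[OF D, of f] mass_reduced_pos[OF D] J_up_apply[OF True] by simp
    qed (use J_up_outside E_outside[OF f] in auto)
  qed
qed

text \<open>The space, its inner product and its norm depend on vertices and masses only, so the
  Laplacians of all graphs in the family act on the one space of \<open>G\<close>.\<close>

lemma laplacian_positive_same_mass:
  assumes "bounded_graph H K" and HG: "verts H = verts G" "mass H = mass G"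
  shows "positive_operator G (laplacian H) (2 * K)"
proof -
  interpret H: bounded_graph H K by fact
  have E: "ell2 H = E" and ip: "ell2_inner H = ip" and N: "ell2_norm H = N"
    by (simp_all add: ell2_def ell2_inner_def ell2_norm_def fun_eq_iff HG)
  show ?thesis
    using H.laplacian_positive mass_space_axioms
    unfolding positive_operator_def positive_operator_axioms_def E ip N by blast
qed

text \<open>The weights of \<open>H\<close> are arbitrary on \<open>F\<close>, so a single
  projection serves every \<beta>.\<close>

lemma cluster_kernel_projection:
  assumes H: "bounded_graph H K" and HG: "verts H = verts G" "mass H = mass G" "edges H = F"
  shows "kernel_projection G (laplacian H) (2 * K) (\<lambda>f. J_up G F (J_down G F f))"
proof (rule kernel_projectionI[OF laplacian_positive_same_mass[OF H HG(1,2)]])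
  interpret H: bounded_graph H K by (rule H)
  have E: "ell2 H = E" by (simp add: ell2_def HG)
  fix f assume "f \<in> E"
  then show "laplacian H f = (\<lambda>_. 0) \<longleftrightarrow> J_up G F (J_down G F f) = f"
    by (simp add: J_up_J_down_eq_iff H.laplacian_kernel E HG)
qed

text \<open>Integrating the Laplacian of a lifted function over D gives a double sum over D and
  \<open>V\<close>; partitioning \<open>V\<close> into components yields the reduced weights. Terms
  inside D cancel on both sides.\<close>

lemma laplacian_reduced:
  assumes g: "g \<in> red.E"
  shows "laplacian Gred g = J_down G F (laplacian G (J_up G F g))"
proof
  fix D show "laplacian Gred g D = J_down G F (laplacian G (J_up G F g)) D"
  proof (cases "D \<in> comps")
    case False
    then show ?thesis by (simp add: laplacian_def J_down_def)
  next
    case True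
    let ?h = "J_up G F g"
    have h: "?h \<in> E" by (rule J_up_in_E[OF g])
    have DV: "D \<times> V \<subseteq> V \<times> V" using comps_subset[OF True] by auto
    \<comment> \<open>Finite mass of D is what makes the total weight leaving D finite.\<close>
    have "(\<lambda>x. indicator D x * mass G x :: real) summable_on V"
      by (rule summable_on_indicator_times[OF mass_summable[OF True] comps_subset[OF True]])
    then have "(\<lambda>(x, y). a x y * indicator D x) summable_on V \<times> V"
      by (intro pair_summable) auto
    from summable_on_subset_banach[OF this DV] have s1: "(\<lambda>(x, y). a x y) summable_on D \<times> V"
      by (rule summable_on_cong[THEN iffD1, rotated]) auto
    have "(\<lambda>(x, y). a x y * (cmod (?h y))\<^sup>2) summable_on V \<times> V"
      by (intro pair_summable' E_summable h) auto
    note s2 = summable_on_subset_banach[OF this DV]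
    have s3: "(\<lambda>(x, y). complex_of_real (a x y) * ?h y) summable_on D \<times> V"
    proof (rule abs_summable_summable[OF Infinite_Sum.abs_summable_on_comparison_test'])
      show "(\<lambda>p. (case p of (x, y) \<Rightarrow> a x y) + (case p of (x, y) \<Rightarrow> a x y * (cmod (?h y))\<^sup>2)) summable_on D \<times> V"
        by (intro summable_on_add s1 s2)
      fix p assume "p \<in> D \<times> V"
      then obtain x y where p: "p = (x, y)" "x \<in> V" "y \<in> V" using comps_subset[OF True] by auto
      \<comment> \<open>On D, where the constant 1 is summable against the weights, this trades
        \<open>?h\<close> for its square.\<close>
      have "cmod (?h y) \<le> 1 + (cmod (?h y))\<^sup>2"
        using sum_squares_bound[of 1 "cmod (?h y)", simplified] norm_ge_zero[of "?h y"] by linarith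
      then have "a x y * cmod (?h y) \<le> a x y * (1 + (cmod (?h y))\<^sup>2)"
        using weight_nonneg[OF p(2,3)] by (rule mult_left_mono)
      then show "cmod (case p of (x, y) \<Rightarrow> complex_of_real (a x y) * ?h y)
          \<le> (case p of (x, y) \<Rightarrow> a x y) + (case p of (x, y) \<Rightarrow> a x y * (cmod (?h y))\<^sup>2)"
        using weight_nonneg[OF p(2,3)] by (simp add: p(1) norm_mult distrib_left)
    qed
    have s1': "(\<lambda>(x, y). complex_of_real (a x y) * g D) summable_on D \<times> V"
      using summable_on_cmult_left[OF summable_on_of_real[OF s1], of "g D"]
      by (simp add: case_prod_unfold)
    have partition: "infsum f (D \<times> V) = (\<Sum>\<^sub>\<infinity>D'\<in>comps. infsum f (D \<times> D'))"
      if "f summable_on D \<times> V" for f :: "'v \<times> 'v \<Rightarrow> complex"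
    proof -
      have U: "(\<Union>D'\<in>comps. D \<times> D') = D \<times> V" using Union_comps by auto
      have "disjoint_family_on (\<lambda>D'. D \<times> D') comps"
        using disjoint_comps by (auto simp: disjoint_family_on_def)
      from infsum_disjoint_Union[OF this, of f] that show ?thesis unfolding U by simp
    qed
    have rw: "infsum (\<lambda>(x, y). complex_of_real (a x y) * c) (D \<times> D')
        = complex_of_real (reduced_weight G D D') * c" for D' c
      unfolding reduced_weight_def infsum_complex_of_real[symmetric] infsum_cmult_left'[symmetric]
      by (simp add: case_prod_unfold)
    have "J_down G F (laplacian G ?h) D * complex_of_real (mass Gred D)
        = (\<Sum>\<^sub>\<infinity>x\<in>D. \<Sum>\<^sub>\<infinity>y\<in>V. complex_of_real (a x y) * (g D - ?h y))"
      unfolding J_down_mass[OF True]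
      by (rule infsum_cong) (use comps_subset[OF True] in \<open>auto simp: laplacian_eq J_up_comps[OF True]\<close>)
    also have "\<dots> = infsum (\<lambda>(x, y). complex_of_real (a x y) * (g D - ?h y)) (D \<times> V)"
      using summable_on_add[OF s1' summable_on_uminus[THEN iffD2, OF s3]]
      by (intro infsum_Sigma'_banach) (simp add: case_prod_unfold right_diff_distrib)
    also have "\<dots> = infsum (\<lambda>(x, y). complex_of_real (a x y) * g D) (D \<times> V)
        - infsum (\<lambda>(x, y). complex_of_real (a x y) * ?h y) (D \<times> V)"
      using infsum_add[OF s1' summable_on_uminus[THEN iffD2, OF s3]]
      by (simp add: case_prod_unfold right_diff_distrib infsum_uminus)
    also have "infsum (\<lambda>(x, y). complex_of_real (a x y) * g D) (D \<times> V)
        = complex_of_real (degree Gred D) * g D"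
      unfolding partition[OF s1'] rw infsum_cmult_left' infsum_complex_of_real degree_def reduced_simps ..
    also have "infsum (\<lambda>(x, y). complex_of_real (a x y) * ?h y) (D \<times> V)
        = (\<Sum>\<^sub>\<infinity>D'\<in>comps. complex_of_real (reduced_weight G D D') * g D')"
      unfolding partition[OF s3] rw[symmetric]
      by (intro infsum_cong) (auto simp: J_up_comps)
    finally have "J_down G F (laplacian G ?h) D * complex_of_real (mass Gred D)
        = complex_of_real (degree Gred D) * g D
          - (\<Sum>\<^sub>\<infinity>D'\<in>comps. complex_of_real (reduced_weight G D D') * g D')" .
    then show ?thesis
      using mass_reduced_pos[OF True] True by (simp add: laplacian_def field_simps)
  qed
qed

end

text \<open>A path that starts in the node set of a cluster cannot leave it, since an edge of
  another cluster would make two node sets meet. A vertex outside all node sets is its own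
  component.\<close>

lemma clusters_component_mass:
  assumes cl: "undirected_clusters G I Eh" and x: "x \<in> verts G"
  shows "mass G summable_on (\<Union>i\<in>I. Eh i)\<^sup>* `` {x}"
proof (cases "\<exists>i\<in>I. x \<in> Field (Eh i)")
  case True
  then obtain i where i: "i \<in> I" "x \<in> Field (Eh i)" by blast
  have "(\<Union>i\<in>I. Eh i)\<^sup>* `` {x} \<subseteq> Field (Eh i)"
  proof
    fix y assume "y \<in> (\<Union>i\<in>I. Eh i)\<^sup>* `` {x}"
    then have "(x, y) \<in> (\<Union>i\<in>I. Eh i)\<^sup>*" by simp
    then show "y \<in> Field (Eh i)"
    proof (induction rule: rtrancl_induct)
      case (step y v)
      then obtain j where j: "j \<in> I" "(y, v) \<in> Eh j" by auto
      then have "y \<in> Field (Eh j)" "v \<in> Field (Eh j)" by (auto simp: Field_def)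
      moreover from this have "i = j"
        using cl i(1) j(1) step.IH unfolding undirected_clusters_def by blast
      ultimately show ?case by simp
    qed (rule i(2))
  qed
  moreover have "mass G summable_on Field (Eh i)"
    using cl i(1) by (simp add: undirected_clusters_def)
  ultimately show ?thesis by (rule summable_on_subset_banach[rotated])
next
  case False
  have "y = x" if "(x, y) \<in> (\<Union>i\<in>I. Eh i)\<^sup>*" for y
    using that by (cases rule: converse_rtranclE) (use False in \<open>auto simp: Field_def\<close>)
  then have "(\<Union>i\<in>I. Eh i)\<^sup>* `` {x} = {x}" by auto
  then show ?thesis by simp
qed

section \<open>Both inequalities for the family of graphs\<close>

theorem theorem3p12:
  fixes G :: "'v wgraph"
    and I :: "'i set"
    and Eh :: "'i \<Rightarrow> ('v \<times> 'v) set"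
    and Ehat :: "('v \<times> 'v) set"
    and a :: "real \<Rightarrow> 'v \<Rightarrow> 'v \<Rightarrow> real"
    and G\<^sub>\<beta> :: "real \<Rightarrow> 'v wgraph"
    and L L\<^sub>E :: "real \<Rightarrow> ('v \<Rightarrow> complex) \<Rightarrow> ('v \<Rightarrow> complex)"
    and Gred :: "'v set wgraph"
    and Lred :: "('v set \<Rightarrow> complex) \<Rightarrow> ('v set \<Rightarrow> complex)"
  assumes "undirected_graph G" and "bounded_degree G"
    and "undirected_clusters G I Eh"
    and "Ehat = (\<Union>i\<in>I. Eh i)"
    and "\<And>\<beta>. G\<^sub>\<beta> \<beta> = G\<lparr>weight := a \<beta>\<rparr>"
    and "\<And>\<beta>. \<beta> \<ge> 0 \<Longrightarrow> undirected_graph (G\<^sub>\<beta> \<beta>)"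
    and "\<And>\<beta>. \<beta> \<ge> 0 \<Longrightarrow> bounded_degree (G\<^sub>\<beta> \<beta>)"
    and "\<And>v w. v \<in> verts G \<Longrightarrow> w \<in> verts G \<Longrightarrow> a 0 v w = weight G v w"
    and "\<And>\<beta> \<beta>' i j. 0 \<le> \<beta> \<Longrightarrow> \<beta> < \<beta>' \<Longrightarrow> (i, j) \<in> edges G - Ehat \<Longrightarrow> a \<beta>' i j = weight G i j"
    and "\<And>\<beta> \<beta>' i j. 0 \<le> \<beta> \<Longrightarrow> \<beta> < \<beta>' \<Longrightarrow> (i, j) \<in> Ehat \<Longrightarrow> a \<beta>' i j > a \<beta> i j"
    and "\<And>i j. (i, j) \<in> Ehat \<Longrightarrow> filterlim (\<lambda>\<beta>. a \<beta> i j) at_top at_top"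
    and "\<And>\<beta>. L \<beta> = laplacian (G\<^sub>\<beta> \<beta>)"
    and "\<And>\<beta>. L\<^sub>E \<beta> = laplacian (subgraph (G\<^sub>\<beta> \<beta>) Ehat)"
    and "Gred = reduced_graph G Ehat"
    and "Lred = laplacian Gred"
  shows "\<exists>P. (\<forall>\<beta>\<ge>0. is_orth_proj G P (op_kernel G (L\<^sub>E \<beta>))) \<and>
    (\<forall>z. z \<notin> complex_of_real ` {0..} \<longrightarrow>
      (\<exists>C\<^sub>1>0. \<exists>C\<^sub>2>0. \<forall>\<beta>\<ge>0.
        op_norm G (\<lambda>f x. resolvent G (L \<beta>) z f x
            - J_up G Ehat (resolvent Gred Lred z (J_down G Ehat f)) x)
          \<le> ereal C\<^sub>1 * op_norm G (\<lambda>f x. resolvent G (L\<^sub>E \<beta>) z f x - P f x / (- z)) \<and>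
        ereal C\<^sub>1 * op_norm G (\<lambda>f x. resolvent G (L\<^sub>E \<beta>) z f x - P f x / (- z))
          \<le> ereal C\<^sub>2 * (1 / spectral_gap G (L\<^sub>E \<beta>))))"
proof -
  obtain C where C: "bounded_graph G C" using bounded_graphI[OF assms(1,2)] .
  interpret bounded_graph G C by (rule C)
  have Ehat: "Ehat \<subseteq> edges G" "sym Ehat"
    using assms(3) unfolding assms(4) undirected_clusters_def by (blast, meson sym_UNION)
  interpret clustered_graph G C Ehat
    by unfold_locales (use Ehat clusters_component_mass[OF assms(3)] assms(4) in auto)
  have symR: "sym (edges G - Ehat)"
    using undirected Ehat(2) by (auto simp: undirected_graph_def sym_def)
  let ?R = "laplacian (subgraph G (edges G - Ehat))"
  let ?P = "\<lambda>f. J_up G Ehat (J_down G Ehat f)"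
  have R: "positive_operator G ?R (2 * C)"
    by (rule laplacian_positive_same_mass[OF subgraph_bounded[OF _ symR]]) (auto simp: subgraph_def)
  \<comment> \<open>Lifted functions are constant on components, so cluster edges do not act on them
    and only \<open>?R\<close> is compressed.\<close>
  have Lr_eq: "Lred g = J_down G Ehat (?R (J_up G Ehat g))" if g: "g \<in> red.E" for g
  proof -
    interpret S0: kernel_projection G "laplacian (subgraph G Ehat)" "2 * C" ?P
      by (rule cluster_kernel_projection[OF subgraph_bounded[OF Ehat]]) (simp_all add: subgraph_def)
    have "laplacian (subgraph G Ehat) (J_up G Ehat g) = (\<lambda>_. 0)"
      using S0.P_kernel[of "J_up G Ehat g"] g by simp
    then have "laplacian G (J_up G Ehat g) = ?R (J_up G Ehat g)"
      using laplacian_split[OF Ehat] by (simp add: fun_eq_iff)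
    then show ?thesis using laplacian_reduced[OF g] by (simp add: assms(14,15))
  qed
  have Lr: "positive_operator Gred Lred (2 * C)"
    using positive_operator_cong[OF compression[OF R] Lr_eq] by (simp add: assms(14))
  \<comment> \<open>These operator constants may vary with \<beta>; they stay existential because
    the final constants do not contain them.\<close>
  have S: "\<exists>K. kernel_projection G (L\<^sub>E \<beta>) K ?P"
    and L: "\<exists>K. positive_operator G (L \<beta>) K"
    and L_eq: "L \<beta> f = (\<lambda>x. ?R f x + L\<^sub>E \<beta> f x)" if \<beta>: "0 \<le> \<beta>" for \<beta> f
  proof -
    obtain K where K: "bounded_graph (G\<^sub>\<beta> \<beta>) K" using bounded_graphI[OF assms(6,7)[OF \<beta>]] .
    interpret B: bounded_graph "G\<^sub>\<beta> \<beta>" K by (rule K)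
    have B: "verts (G\<^sub>\<beta> \<beta>) = verts G" "mass (G\<^sub>\<beta> \<beta>) = mass G" "edges (G\<^sub>\<beta> \<beta>) = edges G"
      "weight (G\<^sub>\<beta> \<beta>) = a \<beta>" by (simp_all add: assms(5))
    show "\<exists>K. kernel_projection G (L\<^sub>E \<beta>) K ?P"
      unfolding assms(13)
      by (intro exI, rule cluster_kernel_projection[OF B.subgraph_bounded])
        (use Ehat B in \<open>auto simp: subgraph_def\<close>)
    show "\<exists>K. positive_operator G (L \<beta>) K"
      unfolding assms(12) by (intro exI, rule laplacian_positive_same_mass[OF K]) (use B in auto)
    \<comment> \<open>The monotonicity hypothesis speaks of a strictly larger parameter, so \<beta>
      = 0 is settled by the initial condition.\<close>
    have w: "a \<beta> v w = weight G v w" if "(v, w) \<in> edges G - Ehat" for v w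
    proof (cases "\<beta> = 0")
      case True
      then show ?thesis using assms(8) edge_verts that by auto
    next
      case False
      then show ?thesis using assms(9)[of 0 \<beta>] that \<beta> by simp
    qed
    have "weight (subgraph (G\<^sub>\<beta> \<beta>) (edges G - Ehat)) = weight (subgraph G (edges G - Ehat))"
      by (simp add: subgraph_def B w fun_eq_iff)
    then have "laplacian (subgraph (G\<^sub>\<beta> \<beta>) (edges G - Ehat)) f = ?R f"
      by (simp add: laplacian_def degree_def fun_eq_iff) (simp add: subgraph_def B)
    then show "L \<beta> f = (\<lambda>x. ?R f x + L\<^sub>E \<beta> f x)"
      using B.laplacian_split[of Ehat f] Ehat by (simp add: fun_eq_iff assms(12,13) B)
  qed
  show ?thesis
  proof (intro exI[of _ ?P] conjI allI impI)
    fix \<beta> :: real assume "0 \<le> \<beta>"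
    then obtain K where "kernel_projection G (L\<^sub>E \<beta>) K ?P" using S by blast
    then interpret S: kernel_projection G "L\<^sub>E \<beta>" K ?P .
    show "is_orth_proj G ?P (op_kernel G (L\<^sub>E \<beta>))"
      unfolding is_orth_proj_def op_kernel_def using S.P_kernel S.P_orth S.P_in_E by auto
  next
    fix z :: complex assume z: "z \<notin> complex_of_real ` {0..}"
    obtain w \<delta> where w: "cmod w = 1" "0 < \<delta>" "\<And>t. 0 \<le> t \<Longrightarrow> \<delta> \<le> Re (w * (complex_of_real t - z))"
      using half_plane[OF z] by metis
    \<comment> \<open>Both constants are fixed before \<beta>: they involve only z and the degree
      constant of \<open>G\<close>.\<close>
    define C1 where "C1 = (1 + 2 * C / \<delta>)\<^sup>2"
    define c where "c = 1 + cmod z / \<delta>"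
    have C1: "C1 > 0" unfolding C1_def using C_pos w(2) by (intro zero_less_power add_pos_nonneg) auto
    have c: "c > 0" unfolding c_def using w(2) by (intro add_pos_nonneg) auto
    let ?X = "\<lambda>\<beta>. op_norm G (\<lambda>f x. resolvent G (L\<^sub>E \<beta>) z f x - ?P f x / (- z))"
    have "op_norm G (\<lambda>f x. resolvent G (L \<beta>) z f x
            - J_up G Ehat (resolvent Gred Lred z (J_down G Ehat f)) x) \<le> ereal C1 * ?X \<beta> \<and>
          ereal C1 * ?X \<beta> \<le> ereal (C1 * c) * (1 / spectral_gap G (L\<^sub>E \<beta>))" if \<beta>: "0 \<le> \<beta>" for \<beta>
    proof
      obtain K where S: "kernel_projection G (L\<^sub>E \<beta>) K ?P" using S[OF \<beta>] by blast
      obtain K' where L: "positive_operator G (L \<beta>) K'" using L[OF \<beta>] by blast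
      interpret S: kernel_projection G "L\<^sub>E \<beta>" K ?P by (rule S)
      have X: "?X \<beta> = op_norm G (S.reduced_resolvent z)"
        unfolding S.reduced_resolvent_def[abs_def] ..
      show "op_norm G (\<lambda>f x. resolvent G (L \<beta>) z f x
            - J_up G Ehat (resolvent Gred Lred z (J_down G Ehat f)) x) \<le> ereal C1 * ?X \<beta>"
        unfolding X C1_def assms(14)
        by (rule resolvent_difference_op_norm[OF R S L Lr[unfolded assms(14)] L_eq[OF \<beta>] Lr_eq z w(1,3,2)])
      have "ereal C1 * ?X \<beta> \<le> ereal C1 * (ereal c * (1 / spectral_gap G (L\<^sub>E \<beta>)))"
        unfolding X c_def
        by (rule ereal_mult_left_mono[OF S.reduced_resolvent_op_norm_gap[OF z w(1,3,2)]])
          (use C1 in simp_all)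
      then show "ereal C1 * ?X \<beta> \<le> ereal (C1 * c) * (1 / spectral_gap G (L\<^sub>E \<beta>))"
        by (simp add: mult.assoc flip: times_ereal.simps(1))
    qed
    then show "\<exists>C\<^sub>1>0. \<exists>C\<^sub>2>0. \<forall>\<beta>\<ge>0.
        op_norm G (\<lambda>f x. resolvent G (L \<beta>) z f x
            - J_up G Ehat (resolvent Gred Lred z (J_down G Ehat f)) x)
          \<le> ereal C\<^sub>1 * ?X \<beta> \<and>
        ereal C\<^sub>1 * ?X \<beta> \<le> ereal C\<^sub>2 * (1 / spectral_gap G (L\<^sub>E \<beta>))"
      using C1 mult_pos_pos[OF C1 c] by blast
  qed
qed

end
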